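(* Assume that $\gamma=\mathrm{sign}(\theta-\tau)\frac{\sqrt2}{\sqrt{\alpha^2+\beta^2}}$ is an approximation to $\frac1{\sigma-\tau}$ and is not an eigenvalue of $L$, where $\alpha=\theta-\tau+u^TAt$, $\beta=\theta-\tau+v^TA^Ts$ and $(s,t)$ is the exact solution of the correction equation. Let $\varepsilon$ be the relative error of the approximate solution $(\widetilde s,\widetilde t)$ of the correction equation and $\widetilde\varepsilon$ the accuracy of the expansion vectors. Then $$\varepsilon\le\frac{2\sqrt2\,\delta}{\mathrm{sep}(\gamma,L)\,|\sigma-\tau|\sqrt{\|g_\perp\|^2+\|h_\perp\|^2}}\;\widetilde\varepsilon,\qquad\text{where}\qquad \delta=\frac{\left\|B\begin{bmatrix} u \\ v \end{bmatrix}-\gamma\begin{bmatrix} u \\ v \end{bmatrix}\right\|}{\left\|B\begin{bmatrix} \alpha\gamma u \\ \beta\gamma v \end{bmatrix}-\gamma\begin{bmatrix} u \\ v \end{bmatrix}\right\|}.$$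
   Context: $\|\cdot\|$ is the 2-norm. $A\in\mathbb{R}^{M\times N}$, $M\ge N$, has singular values $\sigma_1,\dots,\sigma_N$ labeled so that $|\sigma_1-\tau|<|\sigma_2-\tau|\le\dots\le|\sigma_N-\tau|$, where the target $\tau>0$ is not a singular value of $A$. $(\sigma,u^*,v^* )=(\sigma_1,u_1,v_1)$ is the corresponding singular triplet: $Av^*=\sigma u^*$, $A^Tu^*=\sigma v^*$, $\|u^*\|=\|v^*\|=1$. Put $$B=\begin{bmatrix} -\tau I_M & A \\ A^T & -\tau I_N \end{bmatrix}^{-1},\qquad w=\frac1{\sqrt2}\begin{bmatrix} u^* \\ v^* \end{bmatrix}.$$ $(\frac1{\sigma-\tau},w)$ is a simple eigenpair of $B$; $W_\perp$ is such that $[w,W_\perp]$ is an orthogonal matrix; $L=W_\perp^TBW_\perp$; and $\mathrm{sep}(\gamma,L)=\|(L-\gamma I)^{-1}\|^{-1}$. $\mathcal U\subset\mathbb{R}^M$, $\mathcal V\subset\mathbb{R}^N$ are $m$-dimensional searching subspaces with orthogonal projectors $P_U$, $P_V$ onto them; $u\in\mathcal U$, $v\in\mathcal V$ are unit vectors; $\theta=u^TAv\ge0$; $(\theta,u,v)$ is a reasonably good but not yet converged approximation to $(\sigma,u^*,v^* )$; $r=\begin{bmatrix} Av-\theta u \\ A^Tu-\theta v \end{bmatrix}$. The correction equation is $$\begin{bmatrix} I_M-uu^T & \\ & I_N-vv^T \end{bmatrix}\begin{bmatrix} -\tau I_M & A \\ A^T & -\tau I_N \end{bmatrix}\begin{bmatrix}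 I_M-uu^T & \\ & I_N-vv^T \end{bmatrix}\begin{bmatrix} s \\ t \end{bmatrix}=-r,\qquad s\perp u,\ t\perp v.$$ For an approximate solution $(\widetilde s,\widetilde t)$ define $\varepsilon=\left\|\begin{bmatrix} \widetilde s \\ \widetilde t \end{bmatrix}-\begin{bmatrix} s \\ t \end{bmatrix}\right\|\Big/\left\|\begin{bmatrix} s \\ t \end{bmatrix}\right\|$, and let $[g^T,h^T]^T$ be the normalized error direction: $\begin{bmatrix} \widetilde s \\ \widetilde t \end{bmatrix}=\begin{bmatrix} s \\ t \end{bmatrix}+\varepsilon\left\|\begin{bmatrix} s \\ t \end{bmatrix}\right\|\begin{bmatrix} g \\ h \end{bmatrix}$ with $\|g\|^2+\|h\|^2=1$. Put $g_\perp=(I_M-P_U)g$, $h_\perp=(I_N-P_V)h$. The accuracy of the expansion vectors is $\widetilde\varepsilon=\max\{\widetilde\varepsilon_s,\widetilde\varepsilon_t\}$ with $$\widetilde\varepsilon_s=\frac{\|(I_M-P_U)(\widetilde s-s)\|}{\|(I_M-P_U)s\|},\qquad\widetilde\varepsilon_t=\frac{\|(I_N-P_V)(\widetilde t-t)\|}{\|(I_N-P_V)t\|}.$$ All denominators occurring are understood to be nonzero. *)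

theory Defs
  imports "HOL-Analysis.Analysis" "HOL-Computational_Algebra.Polynomial"
begin

text \<open>
  Block vectors and block matrices are indexed by sum types: an element of
  \<^typ>\<open>real ^ ('m + 'n)\<close> is a column of \<open>CARD('m) + CARD('n)\<close> real numbers, and its
  \<^const>\<open>norm\<close> is the 2-norm.
\<close>

definition stack :: "'a ^ 'm \<Rightarrow> 'a ^ 'n \<Rightarrow> 'a ^ ('m + 'n)" where
  "stack x y = (\<chi> i. case i of Inl a \<Rightarrow> x $ a | Inr b \<Rightarrow> y $ b)"

definition hcat :: "'a ^ 'p ^ 'm \<Rightarrow> 'a ^ 'q ^ 'm \<Rightarrow> 'a ^ ('p + 'q) ^ 'm" where
  "hcat X Y = (\<chi> i. stack (X $ i) (Y $ i))"

definition block_matrix ::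
    "'a ^ 'p ^ 'm \<Rightarrow> 'a ^ 'q ^ 'm \<Rightarrow> 'a ^ 'p ^ 'n \<Rightarrow> 'a ^ 'q ^ 'n \<Rightarrow> 'a ^ ('p + 'q) ^ ('m + 'n)" where
  "block_matrix X Y Z W = stack (hcat X Y) (hcat Z W)"

definition outer :: "real ^ 'm \<Rightarrow> real ^ 'n \<Rightarrow> real ^ 'n ^ 'm" where
  "outer x y = (\<chi> i j. x $ i * y $ j)"

text \<open>
  \<^const>\<open>orthogonal_matrix\<close> requires the row and column index types to be identical. Here they may
  be different types; the two equations force them to have the same cardinality.
\<close>

definition orthogonal_square :: "real ^ 'p ^ 'q \<Rightarrow> bool" where
  "orthogonal_square Q \<longleftrightarrow> transpose Q ** Q = mat 1 \<and> Q ** transpose Q = mat 1"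

definition orthogonal_projector :: "real ^ 'n ^ 'n \<Rightarrow> (real ^ 'n) set \<Rightarrow> bool" where
  "orthogonal_projector P S \<longleftrightarrow> P ** P = P \<and> transpose P = P \<and> range ((*v) P) = S"

definition orthonormal_upto :: "nat \<Rightarrow> (nat \<Rightarrow> 'a::real_inner) \<Rightarrow> bool" where
  "orthonormal_upto k x \<longleftrightarrow>
     (\<forall>i\<in>{1..k}. \<forall>j\<in>{1..k}. x i \<bullet> x j = (if i = j then 1 else 0))"

text \<open>
  The thin singular value decomposition: \<open>sv 1, \<dots>, sv N\<close>, with \<open>N = CARD('n)\<close>, are the singular
  values of \<open>A\<close>, counted with multiplicity and in any order. The values of \<open>sv\<close> at other
  indices are irrelevant.
\<close>

definition singular_values :: "real ^ 'n ^ 'm \<Rightarrow> (nat \<Rightarrow> real) \<Rightarrow> bool" where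
  "singular_values A sv \<longleftrightarrow>
     (\<forall>i\<in>{1..CARD('n)}. 0 \<le> sv i) \<and>
     (\<exists>us vs. orthonormal_upto CARD('n) us \<and> orthonormal_upto CARD('n) vs \<and>
        (\<forall>i\<in>{1..CARD('n)}. A *v vs i = sv i *\<^sub>R us i \<and> transpose A *v us i = sv i *\<^sub>R vs i))"

definition singular_triplet :: "real ^ 'n ^ 'm \<Rightarrow> real \<Rightarrow> real ^ 'm \<Rightarrow> real ^ 'n \<Rightarrow> bool" where
  "singular_triplet A \<sigma> u v \<longleftrightarrow>
     A *v v = \<sigma> *\<^sub>R u \<and> transpose A *v u = \<sigma> *\<^sub>R v \<and> norm u = 1 \<and> norm v = 1"

definition eigenpair :: "real ^ 'n ^ 'n \<Rightarrow> real \<Rightarrow> real ^ 'n \<Rightarrow> bool" where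
  "eigenpair X \<mu> x \<longleftrightarrow> x \<noteq> 0 \<and> X *v x = \<mu> *\<^sub>R x"

definition eigenvalue :: "real ^ 'n ^ 'n \<Rightarrow> real \<Rightarrow> bool" where
  "eigenvalue X \<mu> \<longleftrightarrow> (\<exists>x. eigenpair X \<mu> x)"

definition charpoly :: "real ^ 'n ^ 'n \<Rightarrow> real poly" where
  "charpoly X = det (mat [:0, 1:] - (\<chi> i j. [:X $ i $ j:]))"

definition simple_eigenpair :: "real ^ 'n ^ 'n \<Rightarrow> real \<Rightarrow> real ^ 'n \<Rightarrow> bool" where
  "simple_eigenpair X \<mu> x \<longleftrightarrow> eigenpair X \<mu> x \<and> order \<mu> (charpoly X) = 1"

text \<open>The shifted augmented matrix; \<^term>\<open>mat c\<close> is \<open>c\<close> times the identity.\<close>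

definition shifted_aug :: "real \<Rightarrow> real ^ 'n ^ 'm \<Rightarrow> real ^ ('m + 'n) ^ ('m + 'n)" where
  "shifted_aug \<tau> A = block_matrix (mat (- \<tau>)) A (transpose A) (mat (- \<tau>))"

definition sep :: "real \<Rightarrow> real ^ 'k ^ 'k \<Rightarrow> real" where
  "sep \<gamma> L = inverse (onorm ((*v) (matrix_inv (L - mat \<gamma>))))"

definition correction_equation ::
    "real \<Rightarrow> real ^ 'n ^ 'm \<Rightarrow> real \<Rightarrow> real ^ 'm \<Rightarrow> real ^ 'n \<Rightarrow> real ^ 'm \<Rightarrow> real ^ 'n \<Rightarrow> bool" where
  "correction_equation \<tau> A \<theta> u v s t \<longleftrightarrow>
     (let Q = block_matrix (mat 1 - outer u u) 0 0 (mat 1 - outer v v);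
          r = stack (A *v v - \<theta> *\<^sub>R u) (transpose A *v u - \<theta> *\<^sub>R v)
      in (Q ** shifted_aug \<tau> A ** Q) *v stack s t = - r) \<and>
     orthogonal s u \<and> orthogonal t v"

end

theory Submission
  imports Defs
begin

text \<open>
  Write \<open>K\<close> for the shifted augmented matrix. The correction equation says
  \<open>K (u + s, v + t) = (\<alpha> u, \<beta> v)\<close>, so the components of \<open>s\<close>, \<open>t\<close> orthogonal to the searching
  subspaces are those of \<open>B (\<alpha> u, \<beta> v)\<close>. Splitting \<open>u\<close> along \<open>u\<^sup>*\<close> and \<open>v\<close> along \<open>v\<^sup>*\<close> gives one part in
  the \<open>B\<close>-invariant plane spanned by \<open>(u\<^sup>*, 0)\<close> and \<open>(0, v\<^sup>*)\<close>, which is nearly annihilated by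
  \<open>I - P\<close>, and a small remainder. Both contribute at most \<open>sqrt 2\<close> times the sine of the angle between \<open>(u, v)\<close>
  and \<open>w\<close> times \<open>sqrt (\<alpha>\<^sup>2 + \<beta>\<^sup>2) / |\<sigma> - \<tau>|\<close>, and \<open>sep\<close> bounds that sine by the residual
  \<open>B (u, v) - \<gamma> (u, v)\<close>.

  This argument needs \<open>norm B \<le> 1 / |\<sigma> - \<tau>|\<close>, which fails if \<open>\<sigma> > 2 \<tau>\<close> and \<open>M > N\<close>: then \<open>-1 / \<tau>\<close> is an
  eigenvalue of \<open>B\<close> on the kernel of \<open>A\<^sup>T\<close>. In that case the component \<open>e\<close> of \<open>u\<close> in this kernel is
  treated separately. It is amplified by \<open>1 / \<tau>\<close>, but it also enters the residual with the factor
  \<open>|1 / \<tau> + \<gamma>|\<close>, and the distances of \<open>\<gamma>\<close> to the eigenvalues \<open>1 / (\<sigma>\<^sub>2 - \<tau>)\<close>, \<open>-1 / (\<sigma> + \<tau>)\<close>, \<open>-1 / \<tau>\<close>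
  of \<open>L\<close> limit \<open>sep\<close>, together with \<open>|\<gamma>| |\<sigma> - \<tau>| \<le> sqrt 2\<close>, enough to keep the same constant.
\<close>

subsection \<open>Block vectors and the correction equation\<close>

text \<open>The default rule turns \<open>transpose A *v x\<close> into \<open>x v* A\<close>;
  without it both blocks of the augmented matrix keep the same form.\<close>

declare transpose_matrix_vector [simp del]

lemma stack_Inl [simp]: "stack x y $ Inl i = x $ i"
  and stack_Inr [simp]: "stack x y $ Inr j = y $ j"
  by (simp_all add: stack_def)

lemma stack_eq_iff: "stack x y = stack x' y' \<longleftrightarrow> x = x' \<and> y = y'"
  by (metis stack_Inl stack_Inr vec_eq_iff)

lemma vec_sum_eqI:
  fixes p q :: "'a ^ ('m::finite + 'n::finite)"
  assumes "\<And>i. p $ Inl i = q $ Inl i" "\<And>j. p $ Inr j = q $ Inr j"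
  shows "p = q"
  unfolding vec_eq_iff using assms by (metis sum.exhaust)

lemma stack_exhaust:
  obtains x y where "z = stack x y"
  by (rule that[of "\<chi> i. z $ Inl i" "\<chi> j. z $ Inr j"], rule vec_sum_eqI) simp_all

lemma stack_add: "stack x y + stack x' y' = stack (x + x') (y + y')"
  and stack_diff: "stack a b - stack a' b' = stack (a - a') (b - b')"
  and stack_uminus: "- stack a b = stack (- a) (- b)"
  and stack_scaleR: "c *\<^sub>R stack p q = stack (c *\<^sub>R p) (c *\<^sub>R q)"
  and stack_0: "stack 0 0 = 0"
  by (rule vec_sum_eqI; simp)+

lemma sum_UNIV_sum_type:
  fixes f :: "'a::finite + 'b::finite \<Rightarrow> 'c::comm_monoid_add"
  shows "sum f UNIV = (\<Sum>i\<in>UNIV. f (Inl i)) + (\<Sum>j\<in>UNIV. f (Inr j))"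
  unfolding UNIV_Plus_UNIV[symmetric] by (subst sum.Plus) simp_all

lemma inner_stack: "stack x y \<bullet> stack x' y' = x \<bullet> x' + y \<bullet> y'"
  by (simp add: inner_vec_def sum_UNIV_sum_type)

lemma norm_stack: "(norm (stack x y))\<^sup>2 = (norm x)\<^sup>2 + (norm y)\<^sup>2"
  for x :: "real ^ 'm"
  by (simp add: power2_norm_eq_inner inner_stack)

lemma stack_mult_vec: "stack X Y *v z = stack (X *v z) (Y *v z)"
  by (rule vec_sum_eqI) (simp_all add: matrix_vector_mult_def)

lemma hcat_mult_stack:
  fixes X :: "'a::semiring_1 ^ 'p ^ 'm"
  shows "hcat X Y *v stack x y = X *v x + Y *v y"
  by (simp add: vec_eq_iff hcat_def matrix_vector_mult_def sum_UNIV_sum_type)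

lemma block_matrix_mult_stack:
  fixes X :: "'a::semiring_1 ^ 'p ^ 'm"
  shows "block_matrix X Y Z W *v stack x y = stack (X *v x + Y *v y) (Z *v x + W *v y)"
  by (simp add: block_matrix_def stack_mult_vec hcat_mult_stack)

lemma transpose_hcat: "transpose (hcat X Y) = stack (transpose X) (transpose Y)"
  by (rule vec_sum_eqI) (simp_all add: transpose_def hcat_def vec_eq_iff)

lemma mat_mult_vec: "mat c *v x = c *\<^sub>R (x :: real ^ 'n)"
  by (simp add: vec_eq_iff matrix_vector_mult_def mat_def if_distrib if_distribR cong: if_cong)

lemma shifted_aug_mult_stack:
  "shifted_aug \<tau> A *v stack x y = stack (A *v y - \<tau> *\<^sub>R x) (transpose A *v x - \<tau> *\<^sub>R y)"
  by (simp add: shifted_aug_def block_matrix_mult_stack mat_mult_vec)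

lemma inner_transpose_mult: "(transpose A *v x) \<bullet> y = x \<bullet> (A *v y)"
  for A :: "real ^ 'n ^ 'm"
  by (simp add: transpose_matrix_vector dot_lmul_matrix)

lemma shifted_aug_symmetric: "(shifted_aug \<tau> A *v y) \<bullet> z = y \<bullet> (shifted_aug \<tau> A *v z)"
proof -
  obtain a b c d where "y = stack a b" "z = stack c d"
    by (metis stack_exhaust)
  then show ?thesis
    by (simp add: shifted_aug_mult_stack inner_stack inner_diff_left inner_diff_right
        inner_transpose_mult inner_commute[of _ "transpose A *v c"])
       (simp add: inner_commute)
qed

lemma outer_mult_vec: "outer x y *v z = (y \<bullet> z) *\<^sub>R x"
  by (simp add: vec_eq_iff outer_def matrix_vector_mult_def inner_vec_def sum_distrib_left
      sum_distrib_right mult_ac)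

text \<open>By orthogonality the inner projector fixes \<open>stack s t\<close>, and the outer one
  only subtracts \<open>u \<bullet> (A *v t)\<close> times \<open>u\<close> and
  \<open>v \<bullet> (transpose A *v s)\<close> times \<open>v\<close>. Moving these and the
  residual to the other side leaves \<alpha> and \<beta> as coefficients.\<close>

lemma correction_equation_solution:
  assumes "correction_equation \<tau> A \<theta> u v s t" and "norm u = 1" and "norm v = 1"
  defines "\<alpha> \<equiv> \<theta> - \<tau> + u \<bullet> (A *v t)" and "\<beta> \<equiv> \<theta> - \<tau> + v \<bullet> (transpose A *v s)"
  shows "shifted_aug \<tau> A *v stack (u + s) (v + t) = stack (\<alpha> *\<^sub>R u) (\<beta> *\<^sub>R v)"
    and "s \<bullet> u = 0" and "t \<bullet> v = 0"
proof -
  show [simp]: "s \<bullet> u = 0" "t \<bullet> v = 0"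
    using assms(1) by (auto simp: correction_equation_def orthogonal_def)
  then have [simp]: "u \<bullet> s = 0" "v \<bullet> t = 0"
    by (simp_all add: inner_commute)
  have [simp]: "u \<bullet> u = 1" "v \<bullet> v = 1"
    using assms by (simp_all add: norm_eq_1)
  have "stack (A *v t - \<tau> *\<^sub>R s - (u \<bullet> (A *v t)) *\<^sub>R u)
          (transpose A *v s - \<tau> *\<^sub>R t - (v \<bullet> (transpose A *v s)) *\<^sub>R v)
      = stack (\<theta> *\<^sub>R u - A *v v) (\<theta> *\<^sub>R v - transpose A *v u)"
    using assms(1)
    by (simp add: correction_equation_def Let_def matrix_vector_mul_assoc[symmetric]
        block_matrix_mult_stack shifted_aug_mult_stack matrix_vector_mult_diff_rdistrib
        outer_mult_vec mat_mult_vec inner_diff_right stack_uminus algebra_simps)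
  then show "shifted_aug \<tau> A *v stack (u + s) (v + t) = stack (\<alpha> *\<^sub>R u) (\<beta> *\<^sub>R v)"
    by (simp add: shifted_aug_mult_stack stack_eq_iff \<alpha>_def \<beta>_def
        matrix_vector_right_distrib algebra_simps)
qed

section \<open>Projectors, the complement of \<open>w\<close>, and sep\<close>

lemma orthogonal_projector_complement:
  assumes "orthogonal_projector P S"
  shows "x \<in> S \<Longrightarrow> (mat 1 - P) *v x = 0"
    and "norm ((mat 1 - P) *v y) \<le> norm y"
proof -
  have PP: "P *v (P *v z) = P *v z" for z
    using assms by (simp add: orthogonal_projector_def matrix_vector_mul_assoc)
  have sym: "(P *v a) \<bullet> b = a \<bullet> (P *v b)" for a b
    using assms inner_transpose_mult[of P a b] by (simp add: orthogonal_projector_def)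
  have cp: "(mat 1 - P) *v z = z - P *v z" for z
    by (simp add: matrix_vector_mult_diff_rdistrib)
  show "(mat 1 - P) *v x = 0" if "x \<in> S"
    using that assms PP by (auto simp: cp orthogonal_projector_def)
  have "(norm y)\<^sup>2 = (norm (P *v y))\<^sup>2 + (norm (y - P *v y))\<^sup>2"
    by (simp add: power2_norm_eq_inner inner_diff_left inner_diff_right sym PP)
  then have "(norm (y - P *v y))\<^sup>2 \<le> (norm y)\<^sup>2" by simp
  then show "norm ((mat 1 - P) *v y) \<le> norm y"
    unfolding cp by (rule power2_le_imp_le) simp
qed

text \<open>For \<open>Q = [w, W]\<close>, the identity Q Q^T = I splits every \<open>z\<close> into
  its part along \<open>w\<close> plus W W^T z. It also makes Q^T an isometry, and
  \<open>transpose W *v z\<close> is one block of Q^T z.\<close>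

lemma orthogonal_complement_decomposition:
  fixes W :: "real ^ 'k ^ 'p"
  assumes "orthogonal_square (hcat (columnvector w :: real ^ 1 ^ 'p) W)"
  shows "w \<bullet> y = 0 \<Longrightarrow> W *v (transpose W *v y) = y"
    and "norm (transpose W *v z) \<le> norm z"
proof -
  let ?Q = "hcat (columnvector w :: real ^ 1 ^ 'p) W"
  have cw: "transpose (columnvector w :: real ^ 1 ^ 'p) *v z = vec (w \<bullet> z)" for z
    by (simp add: vec_eq_iff transpose_def columnvector_def matrix_vector_mult_def inner_vec_def)
  have cv: "(columnvector w :: real ^ 1 ^ 'p) *v vec c = c *\<^sub>R w" for c
    by (simp add: vec_eq_iff columnvector_def matrix_vector_mult_def)
  have QT: "transpose ?Q *v z = stack (vec (w \<bullet> z)) (transpose W *v z)" for z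
    by (simp add: transpose_hcat stack_mult_vec cw)
  have QQT: "?Q *v (transpose ?Q *v z) = z" for z
    using assms by (simp add: orthogonal_square_def matrix_vector_mul_assoc)
  have dec: "(w \<bullet> z) *\<^sub>R w + W *v (transpose W *v z) = z" for z
    using QQT[of z] by (simp add: QT hcat_mult_stack cv)
  then show "W *v (transpose W *v y) = y" if "w \<bullet> y = 0"
    using dec[of y] that by simp
  have "(norm z)\<^sup>2 = (norm (transpose ?Q *v z))\<^sup>2"
    unfolding power2_norm_eq_inner inner_transpose_mult by (simp only: QQT)
  also have "\<dots> \<ge> (norm (transpose W *v z))\<^sup>2"
    by (simp add: QT norm_stack)
  finally show "norm (transpose W *v z) \<le> norm z"
    by (rule power2_le_imp_le) simp
qed

lemma matrix_inv_mult:
  fixes M :: "real ^ 'k ^ 'k"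
  assumes "invertible M"
  shows "M ** matrix_inv M = mat 1" "matrix_inv M ** M = mat 1"
  using someI_ex[of "\<lambda>M'. M ** M' = mat 1 \<and> M' ** M = mat 1"] assms
  by (simp_all add: matrix_inv_def invertible_def)

lemma invertible_shift_of_not_eigenvalue:
  assumes "\<not> eigenvalue L \<gamma>" shows "invertible (L - mat \<gamma>)"
proof -
  have "x = 0" if "(L - mat \<gamma>) *v x = 0" for x
    using that assms by (auto simp: eigenvalue_def eigenpair_def matrix_vector_mult_diff_rdistrib mat_mult_vec)
  then show ?thesis
    by (simp add: invertible_left_inverse matrix_left_invertible_ker)
qed

text \<open>The inverse of \<open>L - mat \<gamma>\<close> cannot be the zero map, so its operator
  norm is positive.\<close>

lemma sep_pos:
  fixes L :: "real ^ 'k ^ 'k"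
  assumes "\<not> eigenvalue L \<gamma>" shows "0 < sep \<gamma> L"
proof -
  let ?M = "L - mat \<gamma>"
  have "?M ** matrix_inv ?M = mat 1"
    using invertible_shift_of_not_eigenvalue[OF assms] by (rule matrix_inv_mult(1))
  then have "\<not> (\<forall>x. matrix_inv ?M *v x = 0)"
    by (metis matrix_vector_mul_assoc matrix_vector_mul_lid matrix_vector_mult_0_right
        zero_neq_one vec_eq_iff one_index zero_index)
  then have "0 < onorm ((*v) (matrix_inv ?M))"
    by (simp add: onorm_pos_lt)
  then show ?thesis by (simp add: sep_def)
qed

lemma sep_le:
  fixes L :: "real ^ 'k ^ 'k"
  assumes "\<not> eigenvalue L \<gamma>"
  shows "sep \<gamma> L * norm x \<le> norm ((L - mat \<gamma>) *v x)"
proof -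
  let ?M = "L - mat \<gamma>"
  have "matrix_inv ?M ** ?M = mat 1"
    using invertible_shift_of_not_eigenvalue[OF assms] by (rule matrix_inv_mult(2))
  then have "norm x = norm (matrix_inv ?M *v (?M *v x))"
    by (simp add: matrix_vector_mul_assoc)
  also have "\<dots> \<le> onorm ((*v) (matrix_inv ?M)) * norm (?M *v x)"
    by (rule onorm) simp
  finally show ?thesis
    using sep_pos[OF assms] by (simp add: sep_def field_simps)
qed

text \<open>A vector orthogonal to \<open>w\<close> has coordinates \<open>transpose W *v y\<close>
  of the same length, in which \<open>B\<close> becomes \<open>L\<close>; compressing the residual
  can only shorten it. The later estimates use sep only through this inequality and its sign, under
  the name \<open>a\<close>.\<close>

lemma sep_compression_le:
  fixes W :: "real ^ 'k ^ 'p"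
  assumes "orthogonal_square (hcat (columnvector w :: real ^ 1 ^ 'p) W)"
    and "L = transpose W ** B ** W" and "\<not> eigenvalue L \<gamma>" and "w \<bullet> y = 0"
  shows "sep \<gamma> L * norm y \<le> norm (B *v y - \<gamma> *\<^sub>R y)"
proof -
  note W = orthogonal_complement_decomposition[OF assms(1)]
  let ?k = "transpose W *v y"
  have "(norm y)\<^sup>2 = (norm ?k)\<^sup>2"
    unfolding power2_norm_eq_inner inner_transpose_mult by (simp add: W(1)[OF assms(4)])
  then have "sep \<gamma> L * norm y = sep \<gamma> L * norm ?k" by simp
  also have "\<dots> \<le> norm ((L - mat \<gamma>) *v ?k)"
    by (rule sep_le[OF assms(3)])
  also have "(L - mat \<gamma>) *v ?k = transpose W *v (B *v y - \<gamma> *\<^sub>R y)"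
    by (simp add: assms(2) matrix_vector_mult_diff_rdistrib mat_mult_vec matrix_vector_mult_diff_distrib
        matrix_vector_mul_assoc[symmetric] W(1)[OF assms(4)] matrix_vector_mult_scaleR)
  also have "norm \<dots> \<le> norm (B *v y - \<gamma> *\<^sub>R y)" by (rule W(2))
  finally show ?thesis .
qed

subsection \<open>Lower bounds from the singular value decomposition\<close>

text \<open>The difference \<open>y - p y\<close> is orthogonal to each \<open>x j\<close>, hence to
  the span, so \<open>p\<close> is the orthogonal projection and Pythagoras applies.\<close>

lemma orthonormal_projection:
  fixes x :: "nat \<Rightarrow> 'a::real_inner"
  assumes "orthonormal_upto k x"
  defines "p \<equiv> \<lambda>y. \<Sum>i=1..k. (x i \<bullet> y) *\<^sub>R x i"
  shows "p y \<in> span (x ` {1..k})"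
    and "z \<in> span (x ` {1..k}) \<Longrightarrow> z \<bullet> (y - p y) = 0"
    and "(norm (p y))\<^sup>2 = (\<Sum>i=1..k. (x i \<bullet> y)\<^sup>2)"
    and "(norm y)\<^sup>2 = (norm (p y))\<^sup>2 + (norm (y - p y))\<^sup>2"
proof -
  have on: "x i \<bullet> x j = (if i = j then 1 else 0)" if "i \<in> {1..k}" "j \<in> {1..k}" for i j
    using assms(1) that by (simp add: orthonormal_upto_def)
  show span: "p y \<in> span (x ` {1..k})"
    unfolding p_def by (intro span_sum span_scale span_base) auto
  have xp: "x j \<bullet> p y = x j \<bullet> y" if "j \<in> {1..k}" for j
  proof -
    have "x j \<bullet> p y = (\<Sum>i=1..k. if j = i then x i \<bullet> y else 0)"
      unfolding p_def inner_sum_right by (rule sum.cong) (use on[OF that] in auto)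
    then show ?thesis using that by simp
  qed
  show orth: "z \<bullet> (y - p y) = 0" if "z \<in> span (x ` {1..k})" for z
  proof -
    have "orthogonal (y - p y) z"
      using that by (rule orthogonal_to_span[OF _])
        (auto simp: orthogonal_def inner_commute[of "y - p y"] inner_diff_right xp)
    then show ?thesis by (simp add: orthogonal_def inner_commute)
  qed
  have "(norm (p y))\<^sup>2 = (\<Sum>i=1..k. (x i \<bullet> y) * (x i \<bullet> p y))"
    unfolding power2_norm_eq_inner by (subst (1) p_def) (simp add: inner_sum_left)
  also have "\<dots> = (\<Sum>i=1..k. (x i \<bullet> y)\<^sup>2)"
    by (rule sum.cong) (simp_all add: xp power2_eq_square)
  finally show "(norm (p y))\<^sup>2 = (\<Sum>i=1..k. (x i \<bullet> y)\<^sup>2)" .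
  have "y \<bullet> y = (p y + (y - p y)) \<bullet> (p y + (y - p y))" by simp
  also have "\<dots> = p y \<bullet> p y + (y - p y) \<bullet> (y - p y)"
    using orth[OF span] by (simp only: inner_add_left inner_add_right inner_commute[of "y - p y" "p y"])
  finally show "(norm y)\<^sup>2 = (norm (p y))\<^sup>2 + (norm (y - p y))\<^sup>2"
    by (simp add: power2_norm_eq_inner)
qed

lemma orthonormal_bessel:
  assumes "orthonormal_upto k x"
  shows "(\<Sum>i=1..k. (x i \<bullet> y)\<^sup>2) \<le> (norm y)\<^sup>2"
  using orthonormal_projection(3,4)[OF assms, of y] by simp

lemma orthonormal_expand:
  assumes "orthonormal_upto k x" and "y \<in> span (x ` {1..k})"
  shows "y = (\<Sum>i=1..k. (x i \<bullet> y) *\<^sub>R x i)" and "(norm y)\<^sup>2 = (\<Sum>i=1..k. (x i \<bullet> y)\<^sup>2)"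
proof -
  let ?p = "\<Sum>i=1..k. (x i \<bullet> y) *\<^sub>R x i"
  have "y - ?p \<in> span (x ` {1..k})"
    using assms orthonormal_projection(1) by (intro span_diff)
  then have "(y - ?p) \<bullet> (y - ?p) = 0"
    by (rule orthonormal_projection(2)[OF assms(1)])
  then show "y = ?p" by simp
  then show "(norm y)\<^sup>2 = (\<Sum>i=1..k. (x i \<bullet> y)\<^sup>2)"
    using orthonormal_projection(3)[OF assms(1), of y] by simp
qed

lemma orthonormal_span_UNIV:
  fixes x :: "nat \<Rightarrow> real ^ 'n"
  assumes "orthonormal_upto CARD('n) x"
  shows "span (x ` {1..CARD('n)}) = UNIV"
proof -
  let ?I = "{1..CARD('n)}"
  have on: "x i \<bullet> x j = (if i = j then 1 else 0)" if "i \<in> ?I" "j \<in> ?I" for i j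
    using assms that by (simp add: orthonormal_upto_def)
  have "inj_on x ?I"
    by (rule inj_onI) (metis on zero_neq_one)
  then have "card (x ` ?I) = CARD('n)" by (simp add: card_image)
  moreover have "independent (x ` ?I)"
  proof (rule pairwise_orthogonal_independent)
    show "pairwise orthogonal (x ` ?I)"
      by (auto simp: pairwise_def orthogonal_def on)
    show "0 \<notin> x ` ?I" using on by force
  qed
  ultimately show ?thesis
    using card_ge_dim_independent[of "x ` ?I" UNIV] by auto
qed

text \<open>In coordinates along \<open>us i\<close> and \<open>vs i\<close> the matrix acts by a
  2x2 block with eigenvalues \<open>sv i\<close> - \<tau> and -(\<open>sv i\<close> + \<tau>); the
  second is at least as large in modulus. Restricting \<open>x\<close> leaves out the complement of
  the left singular vectors, where the eigenvalue is -\<tau>.\<close>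

lemma shifted_aug_lower_bound_span:
  fixes A :: "real ^ 'n ^ 'm"
  assumes us: "orthonormal_upto CARD('n) us" and vs: "orthonormal_upto CARD('n) vs"
    and svd: "\<And>i. i \<in> {1..CARD('n)} \<Longrightarrow> A *v vs i = sv i *\<^sub>R us i \<and> transpose A *v us i = sv i *\<^sub>R vs i"
    and nonneg: "\<And>i. i \<in> {1..CARD('n)} \<Longrightarrow> 0 \<le> sv i"
    and gap: "\<And>i. i \<in> {1..CARD('n)} \<Longrightarrow> \<rho> \<le> \<bar>sv i - \<tau>\<bar>"
    and "0 \<le> \<rho>" "0 \<le> \<tau>" and x: "x \<in> span (us ` {1..CARD('n)})"
  shows "\<rho>\<^sup>2 * ((norm x)\<^sup>2 + (norm y)\<^sup>2)
    \<le> (norm (A *v y - \<tau> *\<^sub>R x))\<^sup>2 + (norm (transpose A *v x - \<tau> *\<^sub>R y))\<^sup>2"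
proof -
  let ?I = "{1..CARD('n)}"
  let ?a = "\<lambda>i. us i \<bullet> x" and ?b = "\<lambda>i. vs i \<bullet> y"
  have coord: "\<rho>\<^sup>2 * ((?a i)\<^sup>2 + (?b i)\<^sup>2)
      \<le> (us i \<bullet> (A *v y - \<tau> *\<^sub>R x))\<^sup>2 + (vs i \<bullet> (transpose A *v x - \<tau> *\<^sub>R y))\<^sup>2" if i: "i \<in> ?I" for i
  proof -
    have "us i \<bullet> (A *v y) = sv i * ?b i"
      using svd[OF i] by (simp add: inner_transpose_mult[symmetric])
    moreover have "vs i \<bullet> (transpose A *v x) = sv i * ?a i"
      using svd[OF i] inner_transpose_mult[of A x "vs i"] by (simp add: inner_commute)
    ultimately have eq: "(us i \<bullet> (A *v y - \<tau> *\<^sub>R x))\<^sup>2 + (vs i \<bullet> (transpose A *v x - \<tau> *\<^sub>R y))\<^sup>2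
        = (sv i - \<tau>)\<^sup>2 * ((?a i)\<^sup>2 + (?b i)\<^sup>2) + 2 * \<tau> * sv i * (?a i - ?b i)\<^sup>2"
      by (simp add: inner_diff_right power2_eq_square algebra_simps)
    have "\<rho>\<^sup>2 \<le> (sv i - \<tau>)\<^sup>2"
      using gap[OF i] \<open>0 \<le> \<rho>\<close> by (metis abs_le_square_iff abs_of_nonneg)
    then have "\<rho>\<^sup>2 * ((?a i)\<^sup>2 + (?b i)\<^sup>2) \<le> (sv i - \<tau>)\<^sup>2 * ((?a i)\<^sup>2 + (?b i)\<^sup>2)"
      by (rule mult_right_mono) simp
    moreover have "0 \<le> 2 * \<tau> * sv i * (?a i - ?b i)\<^sup>2"
      using nonneg[OF i] \<open>0 \<le> \<tau>\<close> by simp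
    ultimately show ?thesis unfolding eq by simp
  qed
  \<comment> \<open>Parseval on the left, for \<open>x\<close> by hypothesis and for
    \<open>y\<close> because the \<open>vs i\<close> span the whole space; Bessel suffices on the
    right.\<close>
  have "\<rho>\<^sup>2 * ((norm x)\<^sup>2 + (norm y)\<^sup>2) = (\<Sum>i\<in>?I. \<rho>\<^sup>2 * ((?a i)\<^sup>2 + (?b i)\<^sup>2))"
    using orthonormal_expand(2)[OF us x] orthonormal_expand(2)[OF vs] orthonormal_span_UNIV[OF vs]
    by (simp add: sum_distrib_left sum.distrib distrib_left)
  also have "\<dots> \<le> (\<Sum>i\<in>?I. (us i \<bullet> (A *v y - \<tau> *\<^sub>R x))\<^sup>2 + (vs i \<bullet> (transpose A *v x - \<tau> *\<^sub>R y))\<^sup>2)"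
    by (intro sum_mono coord)
  also have "\<dots> \<le> (norm (A *v y - \<tau> *\<^sub>R x))\<^sup>2 + (norm (transpose A *v x - \<tau> *\<^sub>R y))\<^sup>2"
    unfolding sum.distrib by (intro add_mono orthonormal_bessel us vs)
  finally show ?thesis .
qed

lemma range_subset_span_left_singular:
  fixes A :: "real ^ 'n ^ 'm"
  assumes vs: "orthonormal_upto CARD('n) vs"
    and svd: "\<And>i. i \<in> {1..CARD('n)} \<Longrightarrow> A *v vs i = sv i *\<^sub>R us i"
  shows "A *v y \<in> span (us ` {1..CARD('n)})"
proof -
  have "y = (\<Sum>i=1..CARD('n). (vs i \<bullet> y) *\<^sub>R vs i)"
    using orthonormal_expand(1)[OF vs] orthonormal_span_UNIV[OF vs] by simp
  then have "A *v y = A *v (\<Sum>i=1..CARD('n). (vs i \<bullet> y) *\<^sub>R vs i)"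
    by (rule arg_cong)
  also have "\<dots> = (\<Sum>i=1..CARD('n). (vs i \<bullet> y) *\<^sub>R (A *v vs i))"
    by (simp only: linear_sum[OF matrix_vector_mul_linear] matrix_vector_mult_scaleR)
  finally have "A *v y = (\<Sum>i=1..CARD('n). (vs i \<bullet> y) *\<^sub>R (A *v vs i))" .
  moreover have "(vs i \<bullet> y) *\<^sub>R (A *v vs i) \<in> span (us ` {1..CARD('n)})" if "i \<in> {1..CARD('n)}" for i
    using that by (simp add: svd span_scale span_base)
  ultimately show ?thesis by (simp only: span_sum)
qed

text \<open>Testing with \<open>y = transpose A *v e\<close> produces the squared norm of that
  vector.\<close>

lemma transpose_mult_eq_0:
  fixes A :: "real ^ 'n ^ 'm"
  assumes "\<And>y. (A *v y) \<bullet> e = 0" shows "transpose A *v e = 0"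
  using assms[of "transpose A *v e"] inner_transpose_mult[of A e "transpose A *v e"]
  by (simp add: inner_commute)

text \<open>The part \<open>e\<close> of \<open>x\<close> orthogonal to the left singular vectors is
  killed by the transpose of \<open>A\<close>, so the matrix acts on it as -\<tau>; this is where
  \<rho> \<le> \<tau> enters.\<close>

lemma shifted_aug_lower_bound:
  fixes A :: "real ^ 'n ^ 'm"
  assumes us: "orthonormal_upto CARD('n) us" and vs: "orthonormal_upto CARD('n) vs"
    and svd: "\<And>i. i \<in> {1..CARD('n)} \<Longrightarrow> A *v vs i = sv i *\<^sub>R us i \<and> transpose A *v us i = sv i *\<^sub>R vs i"
    and nonneg: "\<And>i. i \<in> {1..CARD('n)} \<Longrightarrow> 0 \<le> sv i"
    and gap: "\<And>i. i \<in> {1..CARD('n)} \<Longrightarrow> \<rho> \<le> \<bar>sv i - \<tau>\<bar>"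
    and "0 \<le> \<rho>" "\<rho> \<le> \<tau>"
  shows "\<rho>\<^sup>2 * ((norm x)\<^sup>2 + (norm y)\<^sup>2)
    \<le> (norm (A *v y - \<tau> *\<^sub>R x))\<^sup>2 + (norm (transpose A *v x - \<tau> *\<^sub>R y))\<^sup>2"
proof -
  define x\<^sub>0 where "x\<^sub>0 = (\<Sum>i=1..CARD('n). (us i \<bullet> x) *\<^sub>R us i)"
  define e where "e = x - x\<^sub>0"
  have x: "x = x\<^sub>0 + e" by (simp add: e_def)
  have x\<^sub>0: "x\<^sub>0 \<in> span (us ` {1..CARD('n)})"
    unfolding x\<^sub>0_def by (rule orthonormal_projection(1)[OF us])
  have perp: "z \<bullet> e = 0" if "z \<in> span (us ` {1..CARD('n)})" for z
    unfolding e_def x\<^sub>0_def using that by (rule orthonormal_projection(2)[OF us])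
  have Ay: "A *v y \<in> span (us ` {1..CARD('n)})" for y
    using vs svd by (intro range_subset_span_left_singular) auto
  have "transpose A *v e = 0"
    using perp[OF Ay] by (rule transpose_mult_eq_0)
  then have At: "transpose A *v x = transpose A *v x\<^sub>0"
    by (simp add: x matrix_vector_right_distrib)
  have pyth: "(norm (p + c *\<^sub>R e))\<^sup>2 = (norm p)\<^sup>2 + c\<^sup>2 * (norm e)\<^sup>2" if "p \<in> span (us ` {1..CARD('n)})" for p c
    using norm_add_Pythagorean[of p "c *\<^sub>R e"] perp[OF that] by (simp add: orthogonal_def power_mult_distrib)
  have "\<rho>\<^sup>2 * ((norm x)\<^sup>2 + (norm y)\<^sup>2) = \<rho>\<^sup>2 * ((norm x\<^sub>0)\<^sup>2 + (norm y)\<^sup>2) + \<rho>\<^sup>2 * (norm e)\<^sup>2"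
    using pyth[OF x\<^sub>0, of 1] by (simp add: x algebra_simps)
  also have "\<dots> \<le> (norm (A *v y - \<tau> *\<^sub>R x\<^sub>0))\<^sup>2 + (norm (transpose A *v x\<^sub>0 - \<tau> *\<^sub>R y))\<^sup>2 + \<tau>\<^sup>2 * (norm e)\<^sup>2"
    using assms x\<^sub>0 by (intro add_mono shifted_aug_lower_bound_span[OF us vs svd nonneg gap] mult_right_mono power_mono) auto
  also have "\<dots> = (norm (A *v y - \<tau> *\<^sub>R x))\<^sup>2 + (norm (transpose A *v x - \<tau> *\<^sub>R y))\<^sup>2"
    using pyth[of "A *v y - \<tau> *\<^sub>R x\<^sub>0" "- \<tau>"] Ay x\<^sub>0
    by (simp add: At span_diff span_scale) (simp add: x algebra_simps)
  finally show ?thesis .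
qed

section \<open>Solution and residual split along the singular directions\<close>

lemma norm_minus_component:
  fixes x y :: "'a::real_inner"
  assumes "norm x = 1"
  shows "(norm (y - (y \<bullet> x) *\<^sub>R x))\<^sup>2 = (norm y)\<^sup>2 - (y \<bullet> x)\<^sup>2"
  using assms by (simp add: norm_eq_1 power2_norm_eq_inner inner_diff_left inner_diff_right
      inner_commute[of x y]) (simp add: power2_eq_square)

text \<open>\<open>Q\<close> sees only the component of \<open>y\<close> orthogonal to
  \<open>x\<close>, whose length is the sine of their angle. It serves to show that a projector
  annihilating \<open>u\<close> is small on \<open>ustar\<close>, and likewise for \<open>v\<close>
  and \<open>vstar\<close>.\<close>

lemma contraction_near_kernel:
  fixes Q :: "real ^ 'p ^ 'q"
  assumes "\<And>x. norm (Q *v x) \<le> norm x" "Q *v x = 0" "norm x = 1" "norm y = 1"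
  shows "(norm (Q *v y))\<^sup>2 \<le> 1 - (x \<bullet> y)\<^sup>2"
proof -
  have "Q *v y = Q *v (y - (x \<bullet> y) *\<^sub>R x)"
    by (simp add: matrix_vector_mult_diff_distrib matrix_vector_mult_scaleR assms)
  then have "(norm (Q *v y))\<^sup>2 \<le> (norm (y - (x \<bullet> y) *\<^sub>R x))\<^sup>2"
    using assms(1) by (simp add: power_mono)
  also have "\<dots> = 1 - (x \<bullet> y)\<^sup>2"
    using norm_minus_component[OF assms(3), of y] assms(4) by (simp add: inner_commute)
  finally show ?thesis .
qed

text \<open>\<open>X\<close> will be the whole space with \<open>e = 0\<close> if \<rho> \<le>
  \<tau>, and otherwise the span of the left singular vectors; \<open>z\<^sub>1\<close>,
  \<open>z\<^sub>2\<close> stand for \<open>u + s\<close>, \<open>v + t\<close>. The part of the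
  solution in the plane of \<open>(ustar, 0)\<close> and \<open>(0, vstar)\<close> is shrunk by
  \<open>S\<close> under the projectors. The remainder comes from the components of
  \<open>u\<^sub>0\<close> and \<open>v\<close> off the singular vectors, bounded by
  \<open>M\<close>, and from \<open>e\<close>, which is inverted exactly with factor 1 / \<tau>. The
  second claim later limits the share of \<open>e\<close>.\<close>

lemma expansion_bound:
  fixes A :: "real ^ 'n ^ 'm"
  assumes "0 < \<rho>" "0 < \<tau>"
    and X: "subspace X" "\<And>y. A *v y \<in> X"
    and lower: "\<And>x y. x \<in> X \<Longrightarrow> \<rho>\<^sup>2 * ((norm x)\<^sup>2 + (norm y)\<^sup>2)
      \<le> (norm (A *v y - \<tau> *\<^sub>R x))\<^sup>2 + (norm (transpose A *v x - \<tau> *\<^sub>R y))\<^sup>2"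
    and triplet: "singular_triplet A \<sigma> ustar vstar" "ustar \<in> X"
    and u: "u = u\<^sub>0 + e" "u\<^sub>0 \<in> X" "\<And>x. x \<in> X \<Longrightarrow> x \<bullet> e = 0" "norm u = 1"
    and v: "norm v = 1"
    and z: "A *v z\<^sub>2 - \<tau> *\<^sub>R z\<^sub>1 = \<alpha> *\<^sub>R u" "transpose A *v z\<^sub>1 - \<tau> *\<^sub>R z\<^sub>2 = \<beta> *\<^sub>R v"
    and QU: "\<And>x. norm (QU *v x) \<le> norm x" "QU *v u = 0"
    and QV: "\<And>x. norm (QV *v x) \<le> norm x" "QV *v v = 0"
    and S: "0 \<le> S" "1 - (u \<bullet> ustar)\<^sup>2 \<le> S\<^sup>2" "1 - (v \<bullet> vstar)\<^sup>2 \<le> S\<^sup>2"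
    and M: "(norm u\<^sub>0)\<^sup>2 - (u \<bullet> ustar)\<^sup>2 \<le> M\<^sup>2" "1 - (v \<bullet> vstar)\<^sup>2 \<le> M\<^sup>2"
  shows "\<rho> * norm (stack (QU *v z\<^sub>1) (QV *v z\<^sub>2)) \<le> sqrt (\<alpha>\<^sup>2 + \<beta>\<^sup>2) * S
    + sqrt ((\<alpha>\<^sup>2 + \<beta>\<^sup>2) * M\<^sup>2 + (\<rho> * \<alpha> * norm e / \<tau>)\<^sup>2)"
    and "\<rho>\<^sup>2 * (norm z\<^sub>2)\<^sup>2 \<le> \<alpha>\<^sup>2 * (norm u\<^sub>0)\<^sup>2 + \<beta>\<^sup>2"
proof -
  define c\<^sub>1 c\<^sub>2 a b where "c\<^sub>1 = u \<bullet> ustar" and "c\<^sub>2 = v \<bullet> vstar"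
    and "a = z\<^sub>1 \<bullet> ustar" and "b = z\<^sub>2 \<bullet> vstar"
  \<comment> \<open>The matrix acts on \<open>(e, 0)\<close> as -\<tau>, so the solution contains
    \<open>- (\<alpha> / \<tau>) *\<^sub>R e\<close>; removing it leaves the solution for
    \<open>u\<^sub>0\<close> in place of \<open>u\<close>.\<close>
  define x\<^sub>0 where "x\<^sub>0 = z\<^sub>1 + (\<alpha> / \<tau>) *\<^sub>R e"
  have Av: "A *v vstar = \<sigma> *\<^sub>R ustar" and Au: "transpose A *v ustar = \<sigma> *\<^sub>R vstar"
    and ns: "norm ustar = 1" "norm vstar = 1"
    using triplet by (simp_all add: singular_triplet_def)
  have Ate: "transpose A *v e = 0"
    by (rule transpose_mult_eq_0) (use u X in auto)
  have eq1: "\<tau> *\<^sub>R x\<^sub>0 = A *v z\<^sub>2 - \<alpha> *\<^sub>R u\<^sub>0"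
    using z(1) \<open>0 < \<tau>\<close> by (simp add: x\<^sub>0_def u(1) algebra_simps)
  then have "\<tau> *\<^sub>R x\<^sub>0 \<in> X"
    using X u by (simp add: subspace_diff subspace_scale)
  then have x\<^sub>0: "x\<^sub>0 \<in> X"
    using X(1) \<open>0 < \<tau>\<close> subspace_scale[of X "\<tau> *\<^sub>R x\<^sub>0" "1 / \<tau>"] by simp
  have eq2: "transpose A *v x\<^sub>0 - \<tau> *\<^sub>R z\<^sub>2 = \<beta> *\<^sub>R v"
    using z(2) by (simp add: x\<^sub>0_def matrix_vector_right_distrib matrix_vector_mult_scaleR Ate)
  have "\<rho>\<^sup>2 * ((norm x\<^sub>0)\<^sup>2 + (norm z\<^sub>2)\<^sup>2) \<le> \<alpha>\<^sup>2 * (norm u\<^sub>0)\<^sup>2 + \<beta>\<^sup>2"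
    using lower[OF x\<^sub>0, of z\<^sub>2] by (simp add: eq1 eq2 power_mult_distrib v)
  moreover have "0 \<le> \<rho>\<^sup>2 * (norm x\<^sub>0)\<^sup>2" by simp
  ultimately show "\<rho>\<^sup>2 * (norm z\<^sub>2)\<^sup>2 \<le> \<alpha>\<^sup>2 * (norm u\<^sub>0)\<^sup>2 + \<beta>\<^sup>2"
    unfolding distrib_left by linarith

  have ue: "ustar \<bullet> e = 0" using u triplet by blast
  have a\<^sub>0: "a = x\<^sub>0 \<bullet> ustar" and c\<^sub>1: "c\<^sub>1 = u\<^sub>0 \<bullet> ustar"
    by (simp_all add: a_def c\<^sub>1_def x\<^sub>0_def u(1) inner_add_left ue inner_commute[of e])
  \<comment> \<open>The plane of \<open>(ustar, 0)\<close> and \<open>(0, vstar)\<close> is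
    invariant, so the coordinates \<open>a\<close>, \<open>b\<close> of the solution in it satisfy a
    2x2 system of their own.\<close>
  have "(A *v z\<^sub>2 - \<tau> *\<^sub>R z\<^sub>1) \<bullet> ustar = \<alpha> * c\<^sub>1"
    by (simp add: z c\<^sub>1_def)
  moreover have "(A *v z\<^sub>2) \<bullet> ustar = \<sigma> * b"
    using inner_transpose_mult[of A ustar z\<^sub>2] by (simp add: Au b_def inner_commute)
  ultimately have ab1: "\<sigma> * b - \<tau> * a = \<alpha> * c\<^sub>1"
    by (simp add: inner_diff_left a_def)
  have "(transpose A *v z\<^sub>1 - \<tau> *\<^sub>R z\<^sub>2) \<bullet> vstar = \<beta> * c\<^sub>2"
    by (simp add: z c\<^sub>2_def)
  then have ab2: "\<sigma> * a - \<tau> * b = \<beta> * c\<^sub>2"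
    by (simp add: inner_diff_left inner_transpose_mult Av a_def b_def)

  have c_le: "c\<^sub>1\<^sup>2 \<le> 1" "c\<^sub>2\<^sup>2 \<le> 1"
    using Cauchy_Schwarz_ineq2[of u ustar] Cauchy_Schwarz_ineq2[of v vstar]
    by (simp_all add: c\<^sub>1_def c\<^sub>2_def u(4) v ns abs_square_le_1)
  have "\<rho>\<^sup>2 * ((norm (a *\<^sub>R ustar))\<^sup>2 + (norm (b *\<^sub>R vstar))\<^sup>2)
      \<le> (norm (A *v (b *\<^sub>R vstar) - \<tau> *\<^sub>R (a *\<^sub>R ustar)))\<^sup>2
        + (norm (transpose A *v (a *\<^sub>R ustar) - \<tau> *\<^sub>R (b *\<^sub>R vstar)))\<^sup>2"
    by (rule lower) (use X triplet in \<open>simp add: subspace_scale\<close>)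
  also have "A *v (b *\<^sub>R vstar) - \<tau> *\<^sub>R (a *\<^sub>R ustar) = (\<alpha> * c\<^sub>1) *\<^sub>R ustar"
    by (simp add: matrix_vector_mult_scaleR Av algebra_simps flip: ab1)
  also have "transpose A *v (a *\<^sub>R ustar) - \<tau> *\<^sub>R (b *\<^sub>R vstar) = (\<beta> * c\<^sub>2) *\<^sub>R vstar"
    by (simp add: matrix_vector_mult_scaleR Au algebra_simps flip: ab2)
  finally have "\<rho>\<^sup>2 * (a\<^sup>2 + b\<^sup>2) \<le> \<alpha>\<^sup>2 * c\<^sub>1\<^sup>2 + \<beta>\<^sup>2 * c\<^sub>2\<^sup>2"
    by (simp add: ns power_mult_distrib)
  also have "\<dots> \<le> \<alpha>\<^sup>2 * 1 + \<beta>\<^sup>2 * 1"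
    by (intro add_mono mult_left_mono c_le) auto
  finally have ab: "\<rho>\<^sup>2 * (a\<^sup>2 + b\<^sup>2) \<le> \<alpha>\<^sup>2 + \<beta>\<^sup>2" by simp

  have su: "(norm (QU *v ustar))\<^sup>2 \<le> S\<^sup>2"
    by (rule order_trans[OF contraction_near_kernel[OF QU u(4) ns(1)] S(2)])
  have sv: "(norm (QV *v vstar))\<^sup>2 \<le> S\<^sup>2"
    by (rule order_trans[OF contraction_near_kernel[OF QV v ns(2)] S(3)])

  define p q where "p = stack (QU *v (a *\<^sub>R ustar)) (QV *v (b *\<^sub>R vstar))"
    and "q = stack (QU *v (z\<^sub>1 - a *\<^sub>R ustar)) (QV *v (z\<^sub>2 - b *\<^sub>R vstar))"
  have "(\<rho> * norm p)\<^sup>2 = \<rho>\<^sup>2 * (a\<^sup>2 * (norm (QU *v ustar))\<^sup>2 + b\<^sup>2 * (norm (QV *v vstar))\<^sup>2)"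
    by (simp add: p_def power_mult_distrib norm_stack matrix_vector_mult_scaleR)
  also have "\<dots> \<le> \<rho>\<^sup>2 * (a\<^sup>2 * S\<^sup>2 + b\<^sup>2 * S\<^sup>2)"
    by (intro mult_left_mono add_mono su sv) auto
  also have "\<dots> = (\<rho>\<^sup>2 * (a\<^sup>2 + b\<^sup>2)) * S\<^sup>2" by (simp add: algebra_simps)
  also have "\<dots> \<le> (\<alpha>\<^sup>2 + \<beta>\<^sup>2) * S\<^sup>2" by (intro mult_right_mono ab) auto
  also have "\<dots> = (sqrt (\<alpha>\<^sup>2 + \<beta>\<^sup>2) * S)\<^sup>2" by (simp add: power_mult_distrib)
  finally have p: "\<rho> * norm p \<le> sqrt (\<alpha>\<^sup>2 + \<beta>\<^sup>2) * S"
    by (rule power2_le_imp_le) (use S in simp)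

  \<comment> \<open>The remainder solves the system with the singular components removed from the
    right-hand side, and its first block stays in \<open>X\<close>, so \<open>lower\<close> applies
    to it.\<close>
  let ?x = "x\<^sub>0 - a *\<^sub>R ustar" and ?y = "z\<^sub>2 - b *\<^sub>R vstar"
  have xX: "?x \<in> X" using X triplet x\<^sub>0 by (simp add: subspace_diff subspace_scale)
  have r1: "A *v ?y - \<tau> *\<^sub>R ?x = \<alpha> *\<^sub>R (u\<^sub>0 - c\<^sub>1 *\<^sub>R ustar)"
    using arg_cong[OF ab1, of "\<lambda>k. k *\<^sub>R ustar"] eq1
    by (simp add: matrix_vector_mult_diff_distrib matrix_vector_mult_scaleR Av algebra_simps)
  have r2: "transpose A *v ?x - \<tau> *\<^sub>R ?y = \<beta> *\<^sub>R (v - c\<^sub>2 *\<^sub>R vstar)"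
    using arg_cong[OF ab2, of "\<lambda>k. k *\<^sub>R vstar"] eq2
    by (simp add: matrix_vector_mult_diff_distrib matrix_vector_mult_scaleR Au algebra_simps)
  have n1: "(norm (u\<^sub>0 - c\<^sub>1 *\<^sub>R ustar))\<^sup>2 \<le> M\<^sup>2"
    using M(1) norm_minus_component[OF ns(1), of u\<^sub>0] by (simp flip: c\<^sub>1 c\<^sub>1_def)
  have n2: "(norm (v - c\<^sub>2 *\<^sub>R vstar))\<^sup>2 \<le> M\<^sup>2"
    using M(2) norm_minus_component[OF ns(2), of v] by (simp add: v flip: c\<^sub>2_def)
  have z1: "z\<^sub>1 - a *\<^sub>R ustar = ?x + (- (\<alpha> / \<tau>)) *\<^sub>R e"
    by (simp add: x\<^sub>0_def)
  have pyth: "(norm (z\<^sub>1 - a *\<^sub>R ustar))\<^sup>2 = (norm ?x)\<^sup>2 + (\<alpha> / \<tau> * norm e)\<^sup>2"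
    unfolding z1 using norm_add_Pythagorean[of ?x "(- (\<alpha> / \<tau>)) *\<^sub>R e"] u(3)[OF xX]
    by (simp add: orthogonal_def power_mult_distrib power_divide)
  have "(norm q)\<^sup>2 \<le> (norm (z\<^sub>1 - a *\<^sub>R ustar))\<^sup>2 + (norm ?y)\<^sup>2"
    unfolding q_def norm_stack by (intro add_mono power_mono QU QV) auto
  then have "(\<rho> * norm q)\<^sup>2 \<le> \<rho>\<^sup>2 * ((norm (z\<^sub>1 - a *\<^sub>R ustar))\<^sup>2 + (norm ?y)\<^sup>2)"
    unfolding power_mult_distrib by (rule mult_left_mono) simp
  also have "\<dots> = \<rho>\<^sup>2 * ((norm ?x)\<^sup>2 + (norm ?y)\<^sup>2) + (\<rho> * \<alpha> * norm e / \<tau>)\<^sup>2"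
    unfolding pyth by (simp add: algebra_simps power_mult_distrib power_divide)
  also have "\<rho>\<^sup>2 * ((norm ?x)\<^sup>2 + (norm ?y)\<^sup>2) \<le> \<alpha>\<^sup>2 * M\<^sup>2 + \<beta>\<^sup>2 * M\<^sup>2"
  proof -
    have "\<rho>\<^sup>2 * ((norm ?x)\<^sup>2 + (norm ?y)\<^sup>2)
        \<le> \<alpha>\<^sup>2 * (norm (u\<^sub>0 - c\<^sub>1 *\<^sub>R ustar))\<^sup>2 + \<beta>\<^sup>2 * (norm (v - c\<^sub>2 *\<^sub>R vstar))\<^sup>2"
      using lower[OF xX, of ?y] unfolding r1 r2 by (simp add: power_mult_distrib)
    also have "\<dots> \<le> \<alpha>\<^sup>2 * M\<^sup>2 + \<beta>\<^sup>2 * M\<^sup>2"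
      by (intro add_mono mult_left_mono n1 n2) auto
    finally show ?thesis .
  qed
  finally have "(\<rho> * norm q)\<^sup>2 \<le> (\<alpha>\<^sup>2 + \<beta>\<^sup>2) * M\<^sup>2 + (\<rho> * \<alpha> * norm e / \<tau>)\<^sup>2"
    by (simp add: distrib_right)
  then have q: "\<rho> * norm q \<le> sqrt ((\<alpha>\<^sup>2 + \<beta>\<^sup>2) * M\<^sup>2 + (\<rho> * \<alpha> * norm e / \<tau>)\<^sup>2)"
    by (rule real_le_rsqrt)
  have "stack (QU *v z\<^sub>1) (QV *v z\<^sub>2) = p + q"
    by (simp add: p_def q_def stack_add flip: matrix_vector_right_distrib)
  then have "\<rho> * norm (stack (QU *v z\<^sub>1) (QV *v z\<^sub>2)) \<le> \<rho> * (norm p + norm q)"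
    using \<open>0 < \<rho>\<close> by (simp add: norm_triangle_ineq)
  with p q show "\<rho> * norm (stack (QU *v z\<^sub>1) (QV *v z\<^sub>2)) \<le> sqrt (\<alpha>\<^sup>2 + \<beta>\<^sup>2) * S
    + sqrt ((\<alpha>\<^sup>2 + \<beta>\<^sup>2) * M\<^sup>2 + (\<rho> * \<alpha> * norm e / \<tau>)\<^sup>2)"
    unfolding distrib_left by linarith
qed

lemma eigenvector_inverse:
  fixes B K :: "real ^ 'k ^ 'k"
  assumes "\<And>y. B *v (K *v y) = y" and "K *v y = \<mu> *\<^sub>R y" and "\<mu> \<noteq> 0"
  shows "B *v y = (1 / \<mu>) *\<^sub>R y"
proof -
  have "\<mu> *\<^sub>R (B *v y) = y"
    using assms(1)[of y] by (simp add: assms(2) matrix_vector_mult_scaleR)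
  then have "(1 / \<mu>) *\<^sub>R (\<mu> *\<^sub>R (B *v y)) = (1 / \<mu>) *\<^sub>R y" by simp
  then show ?thesis using assms(3) by simp
qed

text \<open>Split \<open>x\<close> into its parts along the eigenvectors \<open>w\<close> and
  \<open>f\<close> and a rest \<open>y\<close>. Symmetry of \<open>K\<close> keeps
  \<open>B *v y - \<gamma> *\<^sub>R y\<close> orthogonal to both, so the three residuals add by
  Pythagoras. The condition \<open>x \<bullet> f = f \<bullet> f\<close> makes \<open>f\<close> the
  component of \<open>x\<close> in its own direction and admits \<open>f = 0\<close>.\<close>

lemma residual_lower_bound:
  fixes B K :: "real ^ 'k ^ 'k"
  assumes inv: "\<And>y. B *v (K *v y) = y" "\<And>y. K *v (B *v y) = y"
    and sym: "\<And>y z. (K *v y) \<bullet> z = y \<bullet> (K *v z)"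
    and w: "K *v w = \<mu> *\<^sub>R w" "\<mu> \<noteq> 0" "norm w = 1"
    and f: "K *v f = \<nu> *\<^sub>R f" "\<nu> \<noteq> 0" "w \<bullet> f = 0" and x: "x \<bullet> f = f \<bullet> f"
    and gap: "\<And>y. w \<bullet> y = 0 \<Longrightarrow> a * norm y \<le> norm (B *v y - \<gamma> *\<^sub>R y)" and "0 \<le> a"
  shows "(1 / \<mu> - \<gamma>)\<^sup>2 * (w \<bullet> x)\<^sup>2 + a\<^sup>2 * ((norm x)\<^sup>2 - (w \<bullet> x)\<^sup>2 - (norm f)\<^sup>2)
    + (1 / \<nu> - \<gamma>)\<^sup>2 * (norm f)\<^sup>2 \<le> (norm (B *v x - \<gamma> *\<^sub>R x))\<^sup>2"
proof -
  define c where "c = w \<bullet> x"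
  define y where "y = x - c *\<^sub>R w - f"
  have x_eq: "x = y + c *\<^sub>R w + f" by (simp add: y_def)
  have ww: "w \<bullet> w = 1" using w by (simp add: norm_eq_1)
  have wy: "w \<bullet> y = 0" by (simp add: y_def c_def inner_diff_right ww f)
  have fy: "f \<bullet> y = 0"
    using x f(3) by (simp add: y_def inner_diff_right inner_commute)
  define r where "r = B *v y - \<gamma> *\<^sub>R y"
  have orth: "g \<bullet> r = 0" if "K *v g = \<kappa> *\<^sub>R g" "\<kappa> \<noteq> 0" "g \<bullet> y = 0" for g \<kappa>
  proof -
    have "\<kappa> * (g \<bullet> (B *v y)) = g \<bullet> y"
      using sym[of g "B *v y"] that by (simp add: inv)
    then show ?thesis using that by (simp add: r_def inner_diff_right)
  qed
  have wr: "w \<bullet> r = 0" and fr: "f \<bullet> r = 0"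
    using orth[OF w(1,2) wy] orth[OF f(1,2) fy] by auto
  have Bx: "B *v x - \<gamma> *\<^sub>R x = r + ((1 / \<mu> - \<gamma>) * c) *\<^sub>R w + (1 / \<nu> - \<gamma>) *\<^sub>R f"
    by (simp add: x_eq r_def matrix_vector_right_distrib matrix_vector_mult_scaleR
        eigenvector_inverse[OF inv(1) w(1,2)] eigenvector_inverse[OF inv(1) f(1,2)] algebra_simps)
  have pyth: "(norm (y' + c' *\<^sub>R w + d' *\<^sub>R f))\<^sup>2 = (norm y')\<^sup>2 + c'\<^sup>2 + d'\<^sup>2 * (norm f)\<^sup>2"
    if "w \<bullet> y' = 0" "f \<bullet> y' = 0" for y' c' d'
    using that ww f(3)
    by (simp add: power2_norm_eq_inner inner_add_left inner_add_right inner_commute[of f w]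
        inner_commute[of y' w] inner_commute[of y' f])
       (simp add: power2_eq_square)
  have ny: "(norm y)\<^sup>2 = (norm x)\<^sup>2 - c\<^sup>2 - (norm f)\<^sup>2"
    using pyth[OF wy fy, of c 1] by (simp flip: x_eq)
  have "(a * norm y)\<^sup>2 \<le> (norm r)\<^sup>2"
    using gap[OF wy] \<open>0 \<le> a\<close> by (intro power_mono) (auto simp: r_def)
  then show ?thesis
    unfolding Bx pyth[OF wr fr] by (simp add: power_mult_distrib ny c_def)
qed

subsection \<open>Scalar inequalities for the case \<open>\<sigma> > 2 \<tau>\<close>\<close>

text \<open>The constant comes from \<open>(S + sqrt T)\<^sup>2 \<le> 2 * (S\<^sup>2 + T)\<close>;
  this lets the sum from the triangle inequality be compared with a sum of squares.\<close>

lemma mult_add_sqrt_le: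
  fixes a S T n :: real
  assumes "0 \<le> S" "0 \<le> T" "0 \<le> n" "a\<^sup>2 * (S\<^sup>2 + T) \<le> 2 * n\<^sup>2"
  shows "a * (S + sqrt T) \<le> 2 * n"
proof (rule power2_le_imp_le)
  have "(S + sqrt T)\<^sup>2 \<le> 2 * (S\<^sup>2 + T)"
    using sum_squares_bound[of S "sqrt T"] assms by (simp add: power2_sum)
  then have "a\<^sup>2 * (S + sqrt T)\<^sup>2 \<le> a\<^sup>2 * (2 * (S\<^sup>2 + T))"
    by (rule mult_left_mono) simp
  also have "\<dots> = 2 * (a\<^sup>2 * (S\<^sup>2 + T))" by simp
  also have "\<dots> \<le> 2 * (2 * n\<^sup>2)" using assms(4) by simp
  finally show "(a * (S + sqrt T))\<^sup>2 \<le> (2 * n)\<^sup>2"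
    by (simp add: power_mult_distrib)
qed (use assms in simp)

text \<open>The proof brackets \<open>sqrt 2\<close> by \<open>7/5\<close> and \<open>283/200\<close> to stay with rational polynomials.\<close>

lemma negative_shift_dichotomy_unscaled:
  fixes r y :: real
  assumes "1 < r" "0 < y" "y\<^sup>2 \<le> 2"
  shows "r\<^sup>2 * (2 - y\<^sup>2) \<le> 4 \<or> (y - r / (r + 2))\<^sup>2 \<le> 2 * (1 - y / r)\<^sup>2"
  unfolding disj_imp
proof
  assume "\<not> r\<^sup>2 * (2 - y\<^sup>2) \<le> 4"
  then have gt: "4 < r\<^sup>2 * (2 - y\<^sup>2)" by simp
  have "r\<^sup>2 * (2 - y\<^sup>2) \<le> r\<^sup>2 * 2"
    by (rule mult_left_mono) simp_all
  with gt have "2 < r\<^sup>2" by simp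
  have r: "7/5 < r"
    by (rule power_less_imp_less_base[of _ 2]) (use \<open>2 < r\<^sup>2\<close> assms in \<open>simp_all add: power2_eq_square\<close>)
  have "y\<^sup>2 < r\<^sup>2" using \<open>2 < r\<^sup>2\<close> assms by simp
  then have "y < r" using assms by (intro power_less_imp_less_base[of y 2 r]) auto
  \<comment> \<open>The negated first alternative bounds \<open>y\<^sup>2\<close> by
    \<open>2 - 4 / r\<^sup>2\<close>, which completing the square raises to
    \<open>2 * (1 - 1/r\<^sup>2)\<^sup>2\<close>.\<close>
  have "y \<le> 283/200 * (1 - 1/r\<^sup>2)"
  proof (rule power2_le_imp_le)
    have "y\<^sup>2 \<le> 2 - 4 / r\<^sup>2" using gt assms by (simp add: field_simps)
    also have "\<dots> \<le> 2 * (1 - 1/r\<^sup>2)\<^sup>2"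
      using zero_le_power2[of "1/r\<^sup>2"] by (simp add: power2_diff)
    also have "\<dots> \<le> (283/200 * (1 - 1/r\<^sup>2))\<^sup>2"
      unfolding power_mult_distrib by (rule mult_right_mono) (simp_all add: power2_eq_square)
    finally show "y\<^sup>2 \<le> (283/200 * (1 - 1/r\<^sup>2))\<^sup>2" .
    show "0 \<le> 283/200 * (1 - 1/r\<^sup>2)"
      using \<open>2 < r\<^sup>2\<close> assms by (simp add: field_simps)
  qed
  then have "y * r\<^sup>2 \<le> 283/200 * (r\<^sup>2 - 1)"
    using assms by (simp add: field_simps)
  \<comment> \<open>Clearing denominators in \<open>upper\<close> gives
    \<open>y * ((r + 2) * (r + 7/5)) \<le> r * (12/5 * r + 14/5)\<close>, proved here after
    multiplication by \<open>r\<^sup>2\<close> so that the bound on \<open>y * r\<^sup>2\<close> can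
    be inserted.\<close>
  then have "(y * r\<^sup>2) * ((r + 2) * (r + 7/5)) \<le> (283/200 * (r\<^sup>2 - 1)) * ((r + 2) * (r + 7/5))"
    by (rule mult_right_mono) (use assms in simp)
  also have "\<dots> \<le> r ^ 3 * (12/5 * r + 14/5)"
  proof -
    \<comment> \<open>Certificate of nonnegativity: a positive multiple of a square plus a
      polynomial with positive coefficients.\<close>
    have "r ^ 3 * (12/5 * r + 14/5) - 283/200 * (r\<^sup>2 - 1) * ((r + 2) * (r + 7/5))
        = 197/200 * (r\<^sup>2 - 103/100 * r - 183/100)\<^sup>2
          + (181/10000 * r ^ 3 + 26227/2000000 * r\<^sup>2 + 1097747/1000000 * r + 1326667/2000000)"
      by algebra
    moreover have "0 \<le> \<dots>" using assms by (intro add_nonneg_nonneg) auto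
    ultimately show ?thesis by linarith
  qed
  finally have "r\<^sup>2 * (y * ((r + 2) * (r + 7/5))) \<le> r\<^sup>2 * (r * (12/5 * r + 14/5))"
    by (simp add: power2_eq_square power3_eq_cube mult_ac)
  then have "y * ((r + 2) * (r + 7/5)) \<le> r * (12/5 * r + 14/5)"
    using assms by simp
  then have upper: "y - r / (r + 2) \<le> 7/5 * (1 - y / r)"
    using assms by (simp add: field_simps)
  have "7/5 * (y / r) \<le> y" using r assms by (simp add: field_simps)
  moreover have "r / (r + 2) \<le> 1" using assms by simp
  ultimately have lower: "- (7/5 * (1 - y / r)) \<le> y - r / (r + 2)"
    unfolding right_diff_distrib by linarith
  have "\<bar>y - r / (r + 2)\<bar> \<le> 7/5 * (1 - y / r)"
    using upper lower by (intro abs_leI) linarith+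
  then have "(y - r / (r + 2))\<^sup>2 \<le> (7/5 * (1 - y / r))\<^sup>2"
    by (metis abs_ge_zero power2_abs power_mono)
  also have "\<dots> \<le> 2 * (1 - y / r)\<^sup>2"
    unfolding power_mult_distrib by (rule mult_right_mono) (simp_all add: power2_eq_square)
  finally show "(y - r / (r + 2))\<^sup>2 \<le> 2 * (1 - y / r)\<^sup>2" .
qed

text \<open>The previous inequality with \<open>r = \<rho> / \<tau>\<close> and
  \<open>y = \<kappa> * \<rho>\<close>; \<kappa> will be \<open>- \<gamma>\<close>. Either the
  amplification \<rho> / \<tau> is harmless because the kernel component has a small enough share,
  or the distance of \<gamma> to -1 / (\<sigma> + \<tau>) is small enough relative to its distance
  to -1 / \<tau>.\<close>

lemma negative_shift_dichotomy:
  fixes \<rho> \<tau> \<kappa> :: real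
  assumes "0 < \<tau>" "\<tau> < \<rho>" "0 < \<kappa>" "\<kappa>\<^sup>2 * \<rho>\<^sup>2 \<le> 2"
  shows "(\<rho> / \<tau>)\<^sup>2 * (1 - \<kappa>\<^sup>2 * \<rho>\<^sup>2 / 2) \<le> 2 \<or>
    (1 / (\<rho> + 2 * \<tau>) - \<kappa>)\<^sup>2 * (\<rho> / \<tau>)\<^sup>2 \<le> 2 * (1 / \<tau> - \<kappa>)\<^sup>2"
proof -
  have "1 < \<rho> / \<tau>" "0 < \<kappa> * \<rho>" "(\<kappa> * \<rho>)\<^sup>2 \<le> 2"
    using assms by (simp_all add: power_mult_distrib)
  from negative_shift_dichotomy_unscaled[OF this]
  show ?thesis
  proof
    assume "(\<rho> / \<tau>)\<^sup>2 * (2 - (\<kappa> * \<rho>)\<^sup>2) \<le> 4"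
    moreover have "(\<rho> / \<tau>)\<^sup>2 * (2 - (\<kappa> * \<rho>)\<^sup>2) = 2 * ((\<rho> / \<tau>)\<^sup>2 * (1 - \<kappa>\<^sup>2 * \<rho>\<^sup>2 / 2))"
      by (simp add: power_mult_distrib algebra_simps)
    ultimately show ?thesis by simp
  next
    assume *: "(\<kappa> * \<rho> - \<rho> / \<tau> / (\<rho> / \<tau> + 2))\<^sup>2 \<le> 2 * (1 - \<kappa> * \<rho> / (\<rho> / \<tau>))\<^sup>2"
    have shift: "\<rho> / \<tau> + 2 = (\<rho> + 2 * \<tau>) / \<tau>"
      using assms by (simp add: field_simps)
    have frac: "\<rho> / \<tau> / (\<rho> / \<tau> + 2) = \<rho> / (\<rho> + 2 * \<tau>)"
      unfolding shift using assms by simp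
    have "\<kappa> * \<rho> - \<rho> / \<tau> / (\<rho> / \<tau> + 2) = - (\<rho> * (1 / (\<rho> + 2 * \<tau>) - \<kappa>))"
      unfolding frac by (simp add: algebra_simps)
    moreover have "1 - \<kappa> * \<rho> / (\<rho> / \<tau>) = \<tau> * (1 / \<tau> - \<kappa>)"
      using assms by (simp add: field_simps)
    ultimately have "(\<rho> * (1 / (\<rho> + 2 * \<tau>) - \<kappa>))\<^sup>2 \<le> 2 * (\<tau> * (1 / \<tau> - \<kappa>))\<^sup>2"
      using * by simp
    then have "((1 / (\<rho> + 2 * \<tau>) - \<kappa>)\<^sup>2 * (\<rho> / \<tau>)\<^sup>2) * \<tau>\<^sup>2 \<le> (2 * (1 / \<tau> - \<kappa>)\<^sup>2) * \<tau>\<^sup>2"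
      using assms by (simp add: power_mult_distrib power_divide mult_ac)
    then show ?thesis
      using assms by (auto dest: mult_right_le_imp_le)
  qed
qed

text \<open>After multiplication by \<open>\<tau>\<^sup>2\<close>, the first alternative for
  \<open>a\<close> is settled by \<open>\<gamma>\<^sup>2 * \<rho>\<^sup>2 \<le> 2\<close>, the
  second by \<tau> < \<rho>.\<close>

lemma positive_shift_bound:
  fixes \<rho> \<tau> \<gamma> a :: real
  assumes "0 < \<tau>" "\<tau> < \<rho>" "0 < \<gamma>" "\<gamma>\<^sup>2 * \<rho>\<^sup>2 \<le> 2" "0 \<le> a" "a \<le> \<gamma> \<or> a \<le> 1 / \<rho>"
  shows "a\<^sup>2 * (1 + (\<rho> / \<tau>)\<^sup>2) \<le> 2 * (1 / \<tau> + \<gamma>)\<^sup>2"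
proof -
  have "a\<^sup>2 * (\<tau>\<^sup>2 + \<rho>\<^sup>2) \<le> 2 * (1 + \<gamma> * \<tau>)\<^sup>2"
    using assms(6)
  proof
    assume "a \<le> \<gamma>"
    then have "a\<^sup>2 * (\<tau>\<^sup>2 + \<rho>\<^sup>2) \<le> \<gamma>\<^sup>2 * (\<tau>\<^sup>2 + \<rho>\<^sup>2)"
      using assms by (intro mult_right_mono power_mono) auto
    also have "\<dots> \<le> \<gamma>\<^sup>2 * \<tau>\<^sup>2 + 2" using assms by (simp add: distrib_left)
    also have "\<dots> \<le> 2 * (1 + \<gamma> * \<tau>)\<^sup>2"
      using assms by (simp add: power2_sum power_mult_distrib)
    finally show ?thesis .
  next
    assume "a \<le> 1 / \<rho>"
    then have "a\<^sup>2 * (\<tau>\<^sup>2 + \<rho>\<^sup>2) \<le> (1 / \<rho>)\<^sup>2 * (\<rho>\<^sup>2 + \<rho>\<^sup>2)"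
      using assms by (intro mult_mono power_mono add_mono) auto
    also have "\<dots> = 2" using assms by (simp add: power2_eq_square)
    also have "\<dots> \<le> 2 * (1 + \<gamma> * \<tau>)\<^sup>2"
      using assms by (simp add: power2_sum)
    finally show ?thesis .
  qed
  moreover have scale: "(a\<^sup>2 * (1 + (\<rho> / \<tau>)\<^sup>2)) * \<tau>\<^sup>2 = a\<^sup>2 * (\<tau>\<^sup>2 + \<rho>\<^sup>2)"
    "(2 * (1 / \<tau> + \<gamma>)\<^sup>2) * \<tau>\<^sup>2 = 2 * (1 + \<gamma> * \<tau>)\<^sup>2"
    using assms by (simp_all add: field_simps flip: power_mult_distrib)
  ultimately have "(a\<^sup>2 * (1 + (\<rho> / \<tau>)\<^sup>2)) * \<tau>\<^sup>2 \<le> (2 * (1 / \<tau> + \<gamma>)\<^sup>2) * \<tau>\<^sup>2"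
    by (simp only: scale)
  then show ?thesis using assms by (auto dest: mult_right_le_imp_le)
qed

text \<open>
  Here \<open>\<rho>\<close> is \<open>\<sigma> - \<tau>\<close>, \<open>\<nu>\<close> is \<open>1 / (\<sigma>\<^sub>2 - \<tau>)\<close>, \<open>a\<close> is \<open>sep\<close>, and \<open>c\<close>, \<open>e\<close> and the square root of \<open>p\<^sub>2\<close> are the
  lengths of the components of \<open>(u, v)\<close> along \<open>w\<close>, in the kernel of \<open>A\<^sup>T\<close>, and in the rest.
\<close>

lemma residual_dominates:
  fixes \<rho> \<tau> \<gamma> \<nu> a c e p\<^sub>2 S\<^sub>2 M\<^sub>2 E n\<^sub>2 :: real
  assumes "0 < \<tau>" "\<tau> < \<rho>" "\<gamma> \<noteq> 0" "\<gamma>\<^sup>2 * \<rho>\<^sup>2 \<le> 2" "0 \<le> a"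
    and "0 \<le> p\<^sub>2" "p\<^sub>2 + c\<^sup>2 + e\<^sup>2 = 2" "S\<^sub>2 \<le> 1" "S\<^sub>2 \<le> p\<^sub>2 + e\<^sup>2" "M\<^sub>2 \<le> 1" "M\<^sub>2 \<le> p\<^sub>2"
    and "0 \<le> E" "E \<le> e\<^sup>2" "e\<^sup>2 \<le> 1" "E \<le> 1 - \<gamma>\<^sup>2 * \<rho>\<^sup>2 / 2"
    and "0 < \<nu>" "\<nu> < 1 / \<rho>" "a \<le> \<bar>\<nu> - \<gamma>\<bar>" "a \<le> \<bar>1 / (\<rho> + 2 * \<tau>) + \<gamma>\<bar>" "e \<noteq> 0 \<Longrightarrow> a \<le> \<bar>1 / \<tau> + \<gamma>\<bar>"
    and n: "(1 / \<rho> - \<gamma>)\<^sup>2 * c\<^sup>2 + a\<^sup>2 * p\<^sub>2 + (1 / \<tau> + \<gamma>)\<^sup>2 * e\<^sup>2 \<le> n\<^sub>2"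
  shows "a\<^sup>2 * (S\<^sub>2 + M\<^sub>2 + (\<rho> / \<tau>)\<^sup>2 * E) \<le> 2 * n\<^sub>2"
proof (cases "0 < \<gamma>")
  case True
  \<comment> \<open>\<nu> lies between 0 and 1 / \<rho>, so its distance to a positive \<gamma> is
    at most the larger of \<gamma> and 1 / \<rho>.\<close>
  have "a \<le> \<gamma> \<or> a \<le> 1 / \<rho>" using assms True by linarith
  then have *: "a\<^sup>2 * (1 + (\<rho> / \<tau>)\<^sup>2) \<le> 2 * (1 / \<tau> + \<gamma>)\<^sup>2"
    using assms True by (intro positive_shift_bound) auto
  have "(\<rho> / \<tau>)\<^sup>2 * E \<le> (\<rho> / \<tau>)\<^sup>2 * e\<^sup>2" using assms by (intro mult_left_mono) auto
  then have "S\<^sub>2 + M\<^sub>2 + (\<rho> / \<tau>)\<^sup>2 * E \<le> 2 * p\<^sub>2 + (1 + (\<rho> / \<tau>)\<^sup>2) * e\<^sup>2"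
    using assms(9,11) unfolding distrib_right by linarith
  then have "a\<^sup>2 * (S\<^sub>2 + M\<^sub>2 + (\<rho> / \<tau>)\<^sup>2 * E) \<le> a\<^sup>2 * (2 * p\<^sub>2 + (1 + (\<rho> / \<tau>)\<^sup>2) * e\<^sup>2)"
    by (rule mult_left_mono) simp
  also have "\<dots> = 2 * (a\<^sup>2 * p\<^sub>2) + (a\<^sup>2 * (1 + (\<rho> / \<tau>)\<^sup>2)) * e\<^sup>2"
    by (simp add: algebra_simps)
  also have "\<dots> \<le> 2 * (a\<^sup>2 * p\<^sub>2) + (2 * (1 / \<tau> + \<gamma>)\<^sup>2) * e\<^sup>2"
    using * by (intro add_mono order_refl mult_right_mono) auto
  also have "\<dots> \<le> 2 * n\<^sub>2"
  proof -
    have "0 \<le> (1 / \<rho> - \<gamma>)\<^sup>2 * c\<^sup>2" by simp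
    with n show ?thesis by linarith
  qed
  finally show ?thesis .
next
  case False
  define \<kappa> where "\<kappa> = - \<gamma>"
  have \<kappa>: "0 < \<kappa>" "\<gamma> = - \<kappa>" using False assms by (auto simp: \<kappa>_def)
  have "0 < 1 / \<rho>" using assms by simp
  \<comment> \<open>A negative \<gamma> is farther from 1 / \<rho> than from \<nu>, so the component
    along \<open>w\<close> also contributes at least \<open>a\<^sup>2 * c\<^sup>2\<close> to the
    residual.\<close>
  then have "a \<le> 1 / \<rho> - \<gamma>" using assms \<kappa> by linarith
  then have "a\<^sup>2 * c\<^sup>2 \<le> (1 / \<rho> - \<gamma>)\<^sup>2 * c\<^sup>2"
    using assms by (intro mult_right_mono power_mono) auto
  then have n': "a\<^sup>2 * (2 - e\<^sup>2) + (1 / \<tau> - \<kappa>)\<^sup>2 * e\<^sup>2 \<le> n\<^sub>2"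
    using n assms(7) \<kappa> by (simp add: algebra_simps flip: assms(7))
  have e: "a\<^sup>2 * e\<^sup>2 \<le> (1 / \<tau> - \<kappa>)\<^sup>2 * e\<^sup>2"
  proof (cases "e = 0")
    case False
    then have "a\<^sup>2 \<le> \<bar>1 / \<tau> - \<kappa>\<bar>\<^sup>2"
      using assms \<kappa> by (intro power_mono) auto
    then show ?thesis by (intro mult_right_mono) auto
  qed simp
  have "(\<rho> / \<tau>)\<^sup>2 * (1 - \<kappa>\<^sup>2 * \<rho>\<^sup>2 / 2) \<le> 2 \<or>
    (1 / (\<rho> + 2 * \<tau>) - \<kappa>)\<^sup>2 * (\<rho> / \<tau>)\<^sup>2 \<le> 2 * (1 / \<tau> - \<kappa>)\<^sup>2"
    using assms \<kappa> by (intro negative_shift_dichotomy) auto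
  then have "a\<^sup>2 * (2 + (\<rho> / \<tau>)\<^sup>2 * E) \<le> 2 * n\<^sub>2"
  proof
    \<comment> \<open>The amplified term is at most \<open>2 * a\<^sup>2\<close>, and the squared
      residual is at least \<open>2 * a\<^sup>2\<close>.\<close>
    assume *: "(\<rho> / \<tau>)\<^sup>2 * (1 - \<kappa>\<^sup>2 * \<rho>\<^sup>2 / 2) \<le> 2"
    have "(\<rho> / \<tau>)\<^sup>2 * E \<le> (\<rho> / \<tau>)\<^sup>2 * (1 - \<kappa>\<^sup>2 * \<rho>\<^sup>2 / 2)"
      using assms \<kappa> by (intro mult_left_mono) auto
    with * have "a\<^sup>2 * (2 + (\<rho> / \<tau>)\<^sup>2 * E) \<le> a\<^sup>2 * 4"
      by (intro mult_left_mono) auto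
    with e n' show ?thesis by (simp add: algebra_simps)
  next
    \<comment> \<open>The residual of the kernel component absorbs the amplified term; since
      \<open>e\<^sup>2 \<le> 1\<close>, the rest of the doubled squared residual still covers
      \<open>2 * a\<^sup>2\<close>.\<close>
    assume *: "(1 / (\<rho> + 2 * \<tau>) - \<kappa>)\<^sup>2 * (\<rho> / \<tau>)\<^sup>2 \<le> 2 * (1 / \<tau> - \<kappa>)\<^sup>2"
    have "a\<^sup>2 \<le> \<bar>1 / (\<rho> + 2 * \<tau>) - \<kappa>\<bar>\<^sup>2"
      using assms \<kappa> by (intro power_mono) auto
    then have "a\<^sup>2 * (\<rho> / \<tau>)\<^sup>2 \<le> (1 / (\<rho> + 2 * \<tau>) - \<kappa>)\<^sup>2 * (\<rho> / \<tau>)\<^sup>2"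
      by (intro mult_right_mono) auto
    with * have "a\<^sup>2 * (\<rho> / \<tau>)\<^sup>2 \<le> 2 * (1 / \<tau> - \<kappa>)\<^sup>2" by linarith
    then have "a\<^sup>2 * (\<rho> / \<tau>)\<^sup>2 * E \<le> 2 * (1 / \<tau> - \<kappa>)\<^sup>2 * e\<^sup>2"
      by (rule mult_mono) (use assms in auto)
    moreover have "a\<^sup>2 * e\<^sup>2 \<le> a\<^sup>2 * 1" using assms by (intro mult_left_mono) auto
    ultimately show ?thesis using n' by (simp add: algebra_simps)
  qed
  moreover have "a\<^sup>2 * (S\<^sub>2 + M\<^sub>2 + (\<rho> / \<tau>)\<^sup>2 * E) \<le> a\<^sup>2 * (2 + (\<rho> / \<tau>)\<^sup>2 * E)"
    using assms by (intro mult_left_mono) auto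
  ultimately show ?thesis by simp
qed

subsection \<open>The error bound\<close>

lemma gap_le_eigenvalue_distance:
  fixes B K :: "real ^ 'k ^ 'k"
  assumes "\<And>y. B *v (K *v y) = y" "K *v y = \<mu> *\<^sub>R y" "\<mu> \<noteq> 0" "y \<noteq> 0"
    and "a * norm y \<le> norm (B *v y - \<gamma> *\<^sub>R y)"
  shows "a \<le> \<bar>1 / \<mu> - \<gamma>\<bar>"
proof -
  have "B *v y - \<gamma> *\<^sub>R y = (1 / \<mu> - \<gamma>) *\<^sub>R y"
    using eigenvector_inverse[OF assms(1-3)] by (simp add: scaleR_left_diff_distrib)
  then have "a * norm y \<le> \<bar>1 / \<mu> - \<gamma>\<bar> * norm y" using assms(5) by simp
  then show ?thesis using assms(4) by simp
qed

text \<open>The core estimate: \<open>a\<close> stands for sep, \<open>z\<^sub>1\<close> and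
  \<open>z\<^sub>2\<close> for \<open>u + s\<close> and \<open>v + t\<close>, and \<open>QU\<close>,
  \<open>QV\<close> for the complementary projectors. For \<rho> \<le> \<tau> nothing is split off;
  otherwise the kernel component of \<open>u\<close> is treated separately.\<close>

lemma projected_correction_bound:
  fixes A :: "real ^ 'n ^ 'm"
  assumes us: "orthonormal_upto CARD('n) us" and vs: "orthonormal_upto CARD('n) vs"
    and svd: "\<And>i. i \<in> {1..CARD('n)} \<Longrightarrow> A *v vs i = sv i *\<^sub>R us i \<and> transpose A *v us i = sv i *\<^sub>R vs i"
    and nonneg: "\<And>i. i \<in> {1..CARD('n)} \<Longrightarrow> 0 \<le> sv i"
    and gap: "\<And>i. i \<in> {2..CARD('n)} \<Longrightarrow> \<bar>\<sigma> - \<tau>\<bar> < \<bar>sv i - \<tau>\<bar>"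
    and \<sigma>: "\<sigma> = sv 1" "\<sigma> \<noteq> \<tau>" and "0 < \<tau>" and N: "2 \<le> CARD('n)"
    and triplet: "singular_triplet A \<sigma> ustar vstar"
    and w: "w = (1 / sqrt 2) *\<^sub>R stack ustar vstar"
    and inv: "\<And>y. B *v (shifted_aug \<tau> A *v y) = y" "\<And>y. shifted_aug \<tau> A *v (B *v y) = y"
    and a: "0 \<le> a" "\<And>y. w \<bullet> y = 0 \<Longrightarrow> a * norm y \<le> norm (B *v y - \<gamma> *\<^sub>R y)"
    and nu: "norm u = 1" and nv: "norm v = 1"
    and z: "A *v z\<^sub>2 - \<tau> *\<^sub>R z\<^sub>1 = \<alpha> *\<^sub>R u" "transpose A *v z\<^sub>1 - \<tau> *\<^sub>R z\<^sub>2 = \<beta> *\<^sub>R v"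
    and vz: "v \<bullet> z\<^sub>2 = 1"
    and QU: "\<And>x. norm (QU *v x) \<le> norm x" "QU *v u = 0"
    and QV: "\<And>x. norm (QV *v x) \<le> norm x" "QV *v v = 0"
    and \<gamma>: "\<bar>\<gamma>\<bar> * sqrt (\<alpha>\<^sup>2 + \<beta>\<^sup>2) = sqrt 2"
  shows "\<bar>\<sigma> - \<tau>\<bar> * (\<bar>\<gamma>\<bar> * (a * norm (stack (QU *v z\<^sub>1) (QV *v z\<^sub>2))))
    \<le> 2 * sqrt 2 * norm (B *v stack u v - \<gamma> *\<^sub>R stack u v)"
proof -
  let ?I = "{1..CARD('n)}"
  define \<rho> G D x n where "\<rho> = \<bar>\<sigma> - \<tau>\<bar>" and "G = sqrt (\<alpha>\<^sup>2 + \<beta>\<^sup>2)"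
    and "D = norm (stack (QU *v z\<^sub>1) (QV *v z\<^sub>2))"
    and "x = stack u v" and "n = norm (B *v x - \<gamma> *\<^sub>R x)"
  define c\<^sub>1 c\<^sub>2 c where "c\<^sub>1 = u \<bullet> ustar" and "c\<^sub>2 = v \<bullet> vstar" and "c = w \<bullet> x"
  have \<rho>: "0 < \<rho>" "0 \<le> \<rho>" using \<sigma> by (simp_all add: \<rho>_def)
  have G: "\<bar>\<gamma>\<bar> * G = sqrt 2" using \<gamma> by (simp add: G_def)
  moreover have "0 \<le> G" by (simp add: G_def)
  ultimately have "0 < G" "\<gamma> \<noteq> 0" by (auto simp: order_less_le)
  have gap': "\<rho> \<le> \<bar>sv i - \<tau>\<bar>" if "i \<in> ?I" for i
    using that gap[of i] \<sigma> by (cases "i = 1") (auto simp: \<rho>_def)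
  have Av: "A *v vstar = \<sigma> *\<^sub>R ustar" and Au: "transpose A *v ustar = \<sigma> *\<^sub>R vstar"
    and ns: "norm ustar = 1" "norm vstar = 1"
    using triplet by (simp_all add: singular_triplet_def)
  have Kw: "shifted_aug \<tau> A *v w = (\<sigma> - \<tau>) *\<^sub>R w"
    by (simp add: w matrix_vector_mult_scaleR shifted_aug_mult_stack Av Au stack_scaleR
        scaleR_left_diff_distrib diff_divide_distrib)
  have "sqrt 2 = norm (stack ustar vstar)"
    by (rule real_sqrt_unique) (simp_all add: norm_stack ns)
  from this[symmetric] have nw: "norm w = 1" by (simp add: w)
  have nx: "(norm x)\<^sup>2 = 2" by (simp add: x_def norm_stack nu nv)
  have "c = (c\<^sub>1 + c\<^sub>2) / sqrt 2"
    by (simp add: c_def w x_def inner_stack c\<^sub>1_def c\<^sub>2_def inner_commute)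
  then have "c\<^sup>2 = (c\<^sub>1 + c\<^sub>2)\<^sup>2 / 2" by (simp add: power_divide)
  also have "\<dots> \<le> c\<^sub>1\<^sup>2 + c\<^sub>2\<^sup>2" using sum_squares_bound[of c\<^sub>1 c\<^sub>2] by (simp add: power2_sum)
  finally have c: "c\<^sup>2 \<le> c\<^sub>1\<^sup>2 + c\<^sub>2\<^sup>2" .
  have c_le: "c\<^sub>1\<^sup>2 \<le> 1" "c\<^sub>2\<^sup>2 \<le> 1"
    using Cauchy_Schwarz_ineq2[of u ustar] Cauchy_Schwarz_ineq2[of v vstar]
    by (simp_all add: c\<^sub>1_def c\<^sub>2_def nu nv ns abs_square_le_1)
  have "0 \<le> n" by (simp add: n_def)
  \<comment> \<open>Each case supplies its own \<open>Y\<close>; the factor sqrt 2 of the claim is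
    \<open>\<bar>\<gamma>\<bar> * G\<close>.\<close>
  have reduction: "\<rho> * (\<bar>\<gamma>\<bar> * (a * D)) \<le> 2 * sqrt 2 * n" if "\<rho> * D \<le> G * Y" "a * Y \<le> 2 * n" for Y
  proof -
    have "\<rho> * (\<bar>\<gamma>\<bar> * (a * D)) = (\<bar>\<gamma>\<bar> * a) * (\<rho> * D)" by simp
    also have "\<dots> \<le> (\<bar>\<gamma>\<bar> * a) * (G * Y)" using that a by (intro mult_left_mono) auto
    also have "\<dots> = sqrt 2 * (a * Y)" using G by (metis mult.assoc mult.commute)
    also have "\<dots> \<le> sqrt 2 * (2 * n)" using that by (intro mult_left_mono) auto
    finally show ?thesis by simp
  qed
  have "\<rho> * (\<bar>\<gamma>\<bar> * (a * D)) \<le> 2 * sqrt 2 * n"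
  proof (cases "\<rho> \<le> \<tau>")
    case True
    \<comment> \<open>As \<open>(u, v)\<close> has squared norm 2, \<open>q\<close> is the length of
      its component orthogonal to \<open>w\<close>. It dominates both sines and serves as
      \<open>S\<close> and as \<open>M\<close>.\<close>
    define q where "q = sqrt (2 - c\<^sup>2)"
    have q: "q\<^sup>2 = 2 - c\<^sup>2" "0 \<le> q" using c c_le by (simp_all add: q_def)
    have "\<rho> * D \<le> G * q + sqrt ((\<alpha>\<^sup>2 + \<beta>\<^sup>2) * q\<^sup>2 + (\<rho> * \<alpha> * norm (0 :: real ^ 'm) / \<tau>)\<^sup>2)"
      unfolding D_def G_def
    proof (rule expansion_bound(1)[where X = UNIV])
      show "\<rho>\<^sup>2 * ((norm x)\<^sup>2 + (norm y)\<^sup>2)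
        \<le> (norm (A *v y - \<tau> *\<^sub>R x))\<^sup>2 + (norm (transpose A *v x - \<tau> *\<^sub>R y))\<^sup>2" for x y
        by (rule shifted_aug_lower_bound[OF us vs svd nonneg gap' \<rho>(2) True])
    qed (use \<rho> \<open>0 < \<tau>\<close> triplet nu nv z QU QV q c c_le in \<open>auto simp flip: c\<^sub>1_def c\<^sub>2_def\<close>)
    also have "\<dots> = G * (2 * q)"
      by (simp add: G_def real_sqrt_mult q(2))
    finally have "\<rho> * D \<le> G * (2 * q)" .
    moreover have "a * (2 * q) \<le> 2 * n"
    proof -
      \<comment> \<open>No kernel component is split off: \<open>f\<close> is 0, with the arbitrary
        eigenvalue 1.\<close>
      have "(1 / (\<sigma> - \<tau>) - \<gamma>)\<^sup>2 * (w \<bullet> x)\<^sup>2 + a\<^sup>2 * ((norm x)\<^sup>2 - (w \<bullet> x)\<^sup>2 - (norm (0 :: real ^ ('m + 'n)))\<^sup>2)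
        + (1 / 1 - \<gamma>)\<^sup>2 * (norm (0 :: real ^ ('m + 'n)))\<^sup>2 \<le> (norm (B *v x - \<gamma> *\<^sub>R x))\<^sup>2"
        by (rule residual_lower_bound[OF inv shifted_aug_symmetric Kw _ nw _ _ _ _ a(2,1)])
          (use \<sigma> in auto)
      then have "(1 / (\<sigma> - \<tau>) - \<gamma>)\<^sup>2 * c\<^sup>2 + a\<^sup>2 * q\<^sup>2 \<le> n\<^sup>2"
        by (simp add: nx q n_def c_def)
      moreover have "0 \<le> (1 / (\<sigma> - \<tau>) - \<gamma>)\<^sup>2 * c\<^sup>2" by simp
      ultimately have "(a * q)\<^sup>2 \<le> n\<^sup>2" unfolding power_mult_distrib by linarith
      then have "a * q \<le> n" using \<open>0 \<le> n\<close> by (rule power2_le_imp_le)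
      then show ?thesis by simp
    qed
    ultimately show ?thesis by (rule reduction)
  next
    case False
    then have \<tau>\<rho>: "\<tau> < \<rho>" by simp
    have "0 \<le> \<sigma>" using nonneg[of 1] \<sigma> by simp
    \<comment> \<open>If \<sigma> were at most \<tau>, then \<sigma> \<ge> 0 would force \<rho>
      \<le> \<tau>.\<close>
    with \<tau>\<rho> \<open>0 < \<tau>\<close> have \<rho>_eq: "\<rho> = \<sigma> - \<tau>" and "2 * \<tau> < \<sigma>" by (auto simp: \<rho>_def abs_if split: if_splits)
    define X where "X = span (us ` ?I)"
    define u\<^sub>0 where "u\<^sub>0 = (\<Sum>i=1..CARD('n). (us i \<bullet> u) *\<^sub>R us i)"
    define e where "e = u - u\<^sub>0"
    have eX: "y \<bullet> e = 0" if "y \<in> X" for y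
      using that orthonormal_projection(2)[OF us] unfolding X_def e_def u\<^sub>0_def by auto
    have u\<^sub>0X: "u\<^sub>0 \<in> X"
      unfolding X_def u\<^sub>0_def by (rule orthonormal_projection(1)[OF us])
    have nu\<^sub>0: "(norm u\<^sub>0)\<^sup>2 + (norm e)\<^sup>2 = 1"
      using orthonormal_projection(4)[OF us, of u] nu by (simp add: u\<^sub>0_def e_def)
    have AX: "A *v y \<in> X" for y
      unfolding X_def using vs svd by (intro range_subset_span_left_singular) auto
    have uX: "ustar \<in> X"
    proof -
      have "ustar = (1 / \<sigma>) *\<^sub>R (A *v vstar)" using \<open>2 * \<tau> < \<sigma>\<close> \<open>0 < \<tau>\<close> by (simp add: Av)
      then show ?thesis using AX[of vstar] unfolding X_def by (metis span_scale)
    qed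
    have c\<^sub>1: "c\<^sub>1 = u\<^sub>0 \<bullet> ustar"
      using eX[OF uX] by (simp add: c\<^sub>1_def e_def inner_diff_left inner_diff_right inner_commute)
    then have c\<^sub>1_le: "c\<^sub>1\<^sup>2 \<le> (norm u\<^sub>0)\<^sup>2"
      using norm_minus_component[OF ns(1), of u\<^sub>0] by (metis diff_ge_0_iff_ge zero_le_power2)
    \<comment> \<open>\<open>M\<close> differs from \<open>S\<close> by leaving out the kernel
      component \<open>e\<close> of \<open>u\<close>, which is inverted exactly instead.\<close>
    define S M where "S = sqrt (max (1 - c\<^sub>1\<^sup>2) (1 - c\<^sub>2\<^sup>2))" and "M = sqrt (max ((norm u\<^sub>0)\<^sup>2 - c\<^sub>1\<^sup>2) (1 - c\<^sub>2\<^sup>2))"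
    have S: "S\<^sup>2 = max (1 - c\<^sub>1\<^sup>2) (1 - c\<^sub>2\<^sup>2)" "0 \<le> S" and M: "M\<^sup>2 = max ((norm u\<^sub>0)\<^sup>2 - c\<^sub>1\<^sup>2) (1 - c\<^sub>2\<^sup>2)"
      using c_le by (simp_all add: S_def M_def)
    note expansion = expansion_bound[where X = X, OF \<rho>(1) \<open>0 < \<tau>\<close> _ AX _ triplet uX _ u\<^sub>0X eX nu nv z QU QV S(2)]
    have lower: "\<rho>\<^sup>2 * ((norm x)\<^sup>2 + (norm y)\<^sup>2)
        \<le> (norm (A *v y - \<tau> *\<^sub>R x))\<^sup>2 + (norm (transpose A *v x - \<tau> *\<^sub>R y))\<^sup>2" if "x \<in> X" for x y
      using that \<open>0 < \<tau>\<close> unfolding X_def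
      by (intro shifted_aug_lower_bound_span[OF us vs svd nonneg gap' \<rho>(2)]) auto
    have D: "\<rho> * D \<le> G * S + sqrt (G\<^sup>2 * M\<^sup>2 + (\<rho> * \<alpha> * norm e / \<tau>)\<^sup>2)"
      and "\<rho>\<^sup>2 * (norm z\<^sub>2)\<^sup>2 \<le> \<alpha>\<^sup>2 * (norm u\<^sub>0)\<^sup>2 + \<beta>\<^sup>2"
      using expansion[where M = M] lower S M
      by (auto simp: X_def D_def G_def e_def subspace_span simp flip: c\<^sub>1_def c\<^sub>2_def)
    \<comment> \<open>The second block has unit component along \<open>v\<close>, hence norm at
      least 1. This bounds the right-hand side without its kernel part from below, which yields both
      \<open>\<gamma>\<^sup>2 * \<rho>\<^sup>2 \<le> 2\<close> and the limit on
      \<open>E\<close>.\<close>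
    moreover have "\<rho>\<^sup>2 * 1 \<le> \<rho>\<^sup>2 * (norm z\<^sub>2)\<^sup>2"
    proof (rule mult_left_mono)
      have "1 \<le> norm z\<^sub>2" using norm_cauchy_schwarz[of v z\<^sub>2] by (simp add: vz nv)
      then show "1 \<le> (norm z\<^sub>2)\<^sup>2" by simp
    qed simp
    ultimately have "\<rho>\<^sup>2 \<le> \<alpha>\<^sup>2 * (norm u\<^sub>0)\<^sup>2 + \<beta>\<^sup>2" by linarith
    also have "\<dots> = G\<^sup>2 - \<alpha>\<^sup>2 * (norm e)\<^sup>2"
      using arg_cong[OF nu\<^sub>0, of "\<lambda>k. \<alpha>\<^sup>2 * k"] by (simp add: G_def algebra_simps)
    finally have \<rho>G: "\<rho>\<^sup>2 \<le> G\<^sup>2 - \<alpha>\<^sup>2 * (norm e)\<^sup>2" .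
    \<comment> \<open>The share of \<open>e\<close> in the squared length \<open>G\<^sup>2\<close>
      of the right-hand side \<open>(\<alpha> u, \<beta> v)\<close>.\<close>
    define E where "E = \<alpha>\<^sup>2 * (norm e)\<^sup>2 / G\<^sup>2"
    have \<gamma>2: "\<gamma>\<^sup>2 = 2 / G\<^sup>2"
      using arg_cong[OF G, of power2] \<open>0 < G\<close> by (simp add: power_mult_distrib field_simps)
    have E: "E \<le> 1 - \<gamma>\<^sup>2 * \<rho>\<^sup>2 / 2"
      using \<rho>G \<open>0 < G\<close> by (simp add: E_def \<gamma>2 field_simps)
    have "0 \<le> E" by (simp add: E_def)
    have "E \<le> (norm e)\<^sup>2"
      using \<open>0 < G\<close> by (simp add: E_def G_def divide_le_eq algebra_simps)
    define f where "f = stack e (0 :: real ^ 'n)"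
    have nf: "norm f = norm e" by (simp add: f_def norm_stack flip: power2_eq_iff_nonneg)
    have "transpose A *v e = 0" by (rule transpose_mult_eq_0) (rule eX[OF AX])
    then have Kf: "shifted_aug \<tau> A *v f = (- \<tau>) *\<^sub>R f"
      by (simp add: f_def shifted_aug_mult_stack stack_scaleR)
    have wf: "w \<bullet> f = 0" by (simp add: w f_def inner_stack eX[OF uX])
    have xf: "x \<bullet> f = f \<bullet> f"
      using eX[OF u\<^sub>0X] by (simp add: x_def f_def inner_stack e_def inner_diff_left)
    have "(1 / (\<sigma> - \<tau>) - \<gamma>)\<^sup>2 * (w \<bullet> x)\<^sup>2 + a\<^sup>2 * ((norm x)\<^sup>2 - (w \<bullet> x)\<^sup>2 - (norm f)\<^sup>2)
        + (1 / (- \<tau>) - \<gamma>)\<^sup>2 * (norm f)\<^sup>2 \<le> (norm (B *v x - \<gamma> *\<^sub>R x))\<^sup>2"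
      by (rule residual_lower_bound[OF inv shifted_aug_symmetric Kw _ nw Kf _ wf xf a(2,1)])
        (use \<sigma> \<open>0 < \<tau>\<close> in auto)
    moreover have "(1 / (- \<tau>) - \<gamma>)\<^sup>2 = (1 / \<tau> + \<gamma>)\<^sup>2" by (simp add: power2_eq_square algebra_simps)
    ultimately have n: "(1 / \<rho> - \<gamma>)\<^sup>2 * c\<^sup>2 + a\<^sup>2 * (2 - c\<^sup>2 - (norm e)\<^sup>2) + (1 / \<tau> + \<gamma>)\<^sup>2 * (norm e)\<^sup>2 \<le> n\<^sup>2"
      by (simp add: nx nf n_def c_def \<rho>_eq)
    have dist: "a \<le> \<bar>1 / \<mu> - \<gamma>\<bar>"
      if "shifted_aug \<tau> A *v y = \<mu> *\<^sub>R y" "\<mu> \<noteq> 0" "y \<noteq> 0" "w \<bullet> y = 0" for y \<mu>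
      by (rule gap_le_eigenvalue_distance[OF inv(1) that(1-3) a(2)[OF that(4)]])
    have two: "2 \<in> ?I" using N by simp
    \<comment> \<open>The distance of \<open>sv 2\<close> to \<tau> exceeds \<rho> > \<tau>, which a
      nonnegative value below \<tau> cannot achieve.\<close>
    have sv2: "\<rho> < sv 2 - \<tau>"
      using gap[of 2] nonneg[OF two] N \<tau>\<rho> by (auto simp: \<rho>_def abs_if split: if_splits)
    have a1: "a \<le> \<bar>1 / (sv 2 - \<tau>) - \<gamma>\<bar>"
    proof (rule dist)
      note svd2 = svd[OF two]
      show "shifted_aug \<tau> A *v stack (us 2) (vs 2) = (sv 2 - \<tau>) *\<^sub>R stack (us 2) (vs 2)"
        using svd2 by (simp add: shifted_aug_mult_stack stack_scaleR algebra_simps)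
      show "sv 2 - \<tau> \<noteq> 0" using sv2 \<rho> by simp
      have "us 2 \<bullet> us 2 = 1" using us two by (simp add: orthonormal_upto_def)
      then show "stack (us 2) (vs 2) \<noteq> 0"
        by (metis stack_0 stack_eq_iff inner_zero_left zero_neq_one)
      \<comment> \<open>Orthogonality of eigenvectors to different eigenvalues: adding this relation
        and the next isolates the nonzero factor \<open>\<sigma> - sv 2\<close>.\<close>
      have "(us 2 \<bullet> ustar) * \<sigma> = (vs 2 \<bullet> vstar) * sv 2"
        using inner_transpose_mult[of A "us 2" vstar] svd2 by (simp add: Av mult.commute)
      moreover have "(vs 2 \<bullet> vstar) * \<sigma> = (us 2 \<bullet> ustar) * sv 2"
        using inner_transpose_mult[of A ustar "vs 2"] svd2 by (simp add: Au inner_commute mult.commute)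
      ultimately have "(us 2 \<bullet> ustar + vs 2 \<bullet> vstar) * (\<sigma> - sv 2) = 0"
        by (simp add: algebra_simps)
      then have "us 2 \<bullet> ustar + vs 2 \<bullet> vstar = 0" using sv2 \<rho>_eq by simp
      then show "w \<bullet> stack (us 2) (vs 2) = 0"
        by (simp add: w inner_stack inner_commute)
    qed
    have a2: "a \<le> \<bar>1 / (- (\<sigma> + \<tau>)) - \<gamma>\<bar>"
    proof (rule dist)
      show "shifted_aug \<tau> A *v stack ustar (- vstar) = (- (\<sigma> + \<tau>)) *\<^sub>R stack ustar (- vstar)"
        using matrix_vector_mult_scaleR[of A "-1" vstar]
        by (simp add: shifted_aug_mult_stack stack_scaleR Av Au algebra_simps)
      show "- (\<sigma> + \<tau>) \<noteq> 0" using \<open>0 \<le> \<sigma>\<close> \<open>0 < \<tau>\<close> by simp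
      show "stack ustar (- vstar) \<noteq> 0"
        using ns by (metis stack_0 stack_eq_iff norm_zero zero_neq_one)
      show "w \<bullet> stack ustar (- vstar) = 0"
        using ns by (simp add: w inner_stack norm_eq_1)
    qed
    have a3: "a \<le> \<bar>1 / (- \<tau>) - \<gamma>\<bar>" if "norm e \<noteq> 0"
      by (rule dist[OF Kf _ _ wf]) (use that nf \<open>0 < \<tau>\<close> in auto)
    have "a\<^sup>2 * (S\<^sup>2 + M\<^sup>2 + (\<rho> / \<tau>)\<^sup>2 * E) \<le> 2 * n\<^sup>2"
    proof (rule residual_dominates[where \<gamma> = \<gamma> and c = c and e = "norm e" and \<nu> = "1 / (sv 2 - \<tau>)"
          and p\<^sub>2 = "2 - c\<^sup>2 - (norm e)\<^sup>2"])
      show "1 / (sv 2 - \<tau>) < 1 / \<rho>" using sv2 \<rho> by (simp add: frac_less2)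
      show "a \<le> \<bar>1 / (\<rho> + 2 * \<tau>) + \<gamma>\<bar>"
      proof -
        have "1 / (- (\<sigma> + \<tau>)) - \<gamma> = - (1 / (\<rho> + 2 * \<tau>) + \<gamma>)"
          by (simp add: \<rho>_eq del: minus_add_distrib)
        then show ?thesis using a2 by (metis abs_minus_cancel)
      qed
      show "a \<le> \<bar>1 / \<tau> + \<gamma>\<bar>" if "norm e \<noteq> 0"
      proof -
        have "1 / (- \<tau>) - \<gamma> = - (1 / \<tau> + \<gamma>)" by simp
        then show ?thesis using a3[OF that] by (metis abs_minus_cancel)
      qed
      show "\<gamma>\<^sup>2 * \<rho>\<^sup>2 \<le> 2" using E \<open>0 \<le> E\<close> by simp
      have sq: "0 \<le> c\<^sub>1\<^sup>2" "0 \<le> c\<^sub>2\<^sup>2" "0 \<le> (norm e)\<^sup>2" by simp_all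
      show "0 \<le> 2 - c\<^sup>2 - (norm e)\<^sup>2" "S\<^sup>2 \<le> 1" "S\<^sup>2 \<le> 2 - c\<^sup>2 - (norm e)\<^sup>2 + (norm e)\<^sup>2"
        "M\<^sup>2 \<le> 1" "M\<^sup>2 \<le> 2 - c\<^sup>2 - (norm e)\<^sup>2" "(norm e)\<^sup>2 \<le> 1"
        unfolding S(1) M max.bounded_iff using c c_le c\<^sub>1_le nu\<^sub>0 sq
        by (linarith | (rule conjI; linarith))+
    qed (use \<open>0 < \<tau>\<close> \<tau>\<rho> \<open>\<gamma> \<noteq> 0\<close> a(1) a1 E \<open>0 \<le> E\<close> \<open>E \<le> (norm e)\<^sup>2\<close> n sv2 \<rho> in auto)
    then have "a * (S + sqrt (M\<^sup>2 + (\<rho> / \<tau>)\<^sup>2 * E)) \<le> 2 * n"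
      using S \<open>0 \<le> E\<close> \<open>0 \<le> n\<close> by (intro mult_add_sqrt_le) (auto simp: add.assoc)
    moreover have "\<rho> * D \<le> G * (S + sqrt (M\<^sup>2 + (\<rho> / \<tau>)\<^sup>2 * E))"
    proof -
      have "G\<^sup>2 * M\<^sup>2 + (\<rho> * \<alpha> * norm e / \<tau>)\<^sup>2 = G\<^sup>2 * (M\<^sup>2 + (\<rho> / \<tau>)\<^sup>2 * E)"
        using \<open>0 < G\<close> by (simp add: E_def power_mult_distrib power_divide distrib_left)
      then have "sqrt (G\<^sup>2 * M\<^sup>2 + (\<rho> * \<alpha> * norm e / \<tau>)\<^sup>2) = G * sqrt (M\<^sup>2 + (\<rho> / \<tau>)\<^sup>2 * E)"
        using \<open>0 < G\<close> by (simp add: real_sqrt_mult)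
      then show ?thesis using D by (simp add: distrib_left)
    qed
    ultimately show ?thesis by (intro reduction)
  qed
  then show ?thesis by (simp add: \<rho>_def D_def n_def x_def)
qed

section \<open>Dimension count, expansion accuracy and final assembly\<close>

lemma independent_pair_card:
  fixes v t :: "real ^ 'n"
  assumes "t \<bullet> v = 0" "t \<noteq> 0" "v \<noteq> 0"
  shows "2 \<le> CARD('n)"
proof -
  have "t \<noteq> v" using assms by auto
  have "independent {t, v}"
    using assms by (intro pairwise_orthogonal_independent)
      (auto simp: pairwise_def orthogonal_def inner_commute)
  then have "card {t, v} \<le> dim (UNIV :: (real ^ 'n) set)"
    by (rule independent_card_le_dim[rotated]) simp
  then show ?thesis using \<open>t \<noteq> v\<close> by simp
qed

text \<open>\<open>s' - s\<close> and \<open>t' - t\<close> are the same multiple of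
  \<open>g\<close> and \<open>h\<close>, so the numerators of both accuracies are multiples of the
  projected error direction. Replacing each accuracy by the maximum and adding squares gives the
  bound.\<close>

lemma expansion_accuracy_bound:
  fixes PU :: "real ^ 'm ^ 'm" and PV :: "real ^ 'n ^ 'n"
  assumes "stack s' t' = stack s t + (\<epsilon> * norm (stack s t)) *\<^sub>R stack g h" "0 \<le> \<epsilon>"
    and "(mat 1 - PU) *v s \<noteq> 0" and "(mat 1 - PV) *v t \<noteq> 0"
    and "\<epsilon>\<^sub>s = norm ((mat 1 - PU) *v (s' - s)) / norm ((mat 1 - PU) *v s)"
    and "\<epsilon>\<^sub>t = norm ((mat 1 - PV) *v (t' - t)) / norm ((mat 1 - PV) *v t)"
  shows "\<epsilon> * norm (stack s t) * sqrt ((norm ((mat 1 - PU) *v g))\<^sup>2 + (norm ((mat 1 - PV) *v h))\<^sup>2)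
    \<le> max \<epsilon>\<^sub>s \<epsilon>\<^sub>t * norm (stack ((mat 1 - PU) *v s) ((mat 1 - PV) *v t))"
proof (rule power2_le_imp_le)
  let ?k = "\<epsilon> * norm (stack s t)"
  let ?s = "(mat 1 - PU) *v s" and ?t = "(mat 1 - PV) *v t"
  have d: "s' - s = ?k *\<^sub>R g" "t' - t = ?k *\<^sub>R h"
    using assms(1) by (simp_all add: stack_scaleR stack_add stack_eq_iff)
  have pos: "0 \<le> \<epsilon>\<^sub>s" "0 \<le> \<epsilon>\<^sub>t" using assms by simp_all
  have "?k * norm ((mat 1 - PU) *v g) = \<epsilon>\<^sub>s * norm ?s" "?k * norm ((mat 1 - PV) *v h) = \<epsilon>\<^sub>t * norm ?t"
    using assms(2-6) by (simp_all add: d matrix_vector_mult_scaleR)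
  then have "(?k * sqrt ((norm ((mat 1 - PU) *v g))\<^sup>2 + (norm ((mat 1 - PV) *v h))\<^sup>2))\<^sup>2
      = (\<epsilon>\<^sub>s * norm ?s)\<^sup>2 + (\<epsilon>\<^sub>t * norm ?t)\<^sup>2"
    by (metis (no_types) power_mult_distrib distrib_left real_sqrt_pow2 add_nonneg_nonneg zero_le_power2)
  also have "\<dots> \<le> (max \<epsilon>\<^sub>s \<epsilon>\<^sub>t * norm ?s)\<^sup>2 + (max \<epsilon>\<^sub>s \<epsilon>\<^sub>t * norm ?t)\<^sup>2"
    using pos by (intro add_mono power_mono mult_right_mono) auto
  also have "\<dots> = (max \<epsilon>\<^sub>s \<epsilon>\<^sub>t * norm (stack ?s ?t))\<^sup>2"
    by (simp add: power_mult_distrib norm_stack distrib_left)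
  finally show "(?k * sqrt ((norm ((mat 1 - PU) *v g))\<^sup>2 + (norm ((mat 1 - PV) *v h))\<^sup>2))\<^sup>2
    \<le> (max \<epsilon>\<^sub>s \<epsilon>\<^sub>t * norm (stack ?s ?t))\<^sup>2" .
  show "0 \<le> max \<epsilon>\<^sub>s \<epsilon>\<^sub>t * norm (stack ?s ?t)" using pos by (simp add: le_max_iff_disj)
qed

theorem theorem3p6:
  fixes A :: "real ^ 'n ^ 'm"
    and \<tau> \<sigma> :: real and sv :: "nat \<Rightarrow> real"
    and ustar :: "real ^ 'm" and vstar :: "real ^ 'n"
    and B :: "real ^ ('m + 'n) ^ ('m + 'n)" and w :: "real ^ ('m + 'n)"
    and Wperp :: "real ^ 'k ^ ('m + 'n)" and L :: "real ^ 'k ^ 'k"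
    and U :: "(real ^ 'm) set" and V :: "(real ^ 'n) set" and m :: nat
    and PU :: "real ^ 'm ^ 'm" and PV :: "real ^ 'n ^ 'n"
    and u s s' g gperp :: "real ^ 'm" and v t t' h hperp :: "real ^ 'n"
    and \<theta> \<alpha> \<beta> \<gamma> \<delta> \<epsilon> \<epsilon>\<^sub>s \<epsilon>\<^sub>t \<epsilon>' :: real
  assumes "CARD('n) \<le> CARD('m)"
    and "singular_values A sv"
    and "\<forall>i\<in>{2..CARD('n)}. \<bar>sv 1 - \<tau>\<bar> < \<bar>sv i - \<tau>\<bar>"
    and "\<forall>i\<in>{2..<CARD('n)}. \<bar>sv i - \<tau>\<bar> \<le> \<bar>sv (Suc i) - \<tau>\<bar>"
    and "\<tau> > 0" and "\<forall>i\<in>{1..CARD('n)}. sv i \<noteq> \<tau>"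
    and "\<sigma> = sv 1" and "singular_triplet A \<sigma> ustar vstar"
    and "B = matrix_inv (shifted_aug \<tau> A)"
    and "w = (1 / sqrt 2) *\<^sub>R stack ustar vstar"
    and "simple_eigenpair B (1 / (\<sigma> - \<tau>)) w"
    and "orthogonal_square (hcat (columnvector w :: real ^ 1 ^ ('m + 'n)) Wperp)"
    and "L = transpose Wperp ** B ** Wperp"
    and "subspace U" and "dim U = m" and "orthogonal_projector PU U"
    and "subspace V" and "dim V = m" and "orthogonal_projector PV V"
    and "u \<in> U" and "norm u = 1" and "v \<in> V" and "norm v = 1"
    and "\<theta> = u \<bullet> (A *v v)" and "\<theta> \<ge> 0"
    and "correction_equation \<tau> A \<theta> u v s t"
    and "stack s t \<noteq> 0"
    and "\<epsilon> = norm (stack s' t' - stack s t) / norm (stack s t)"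
    and "stack s' t' = stack s t + (\<epsilon> * norm (stack s t)) *\<^sub>R stack g h"
    and "(norm g)\<^sup>2 + (norm h)\<^sup>2 = 1"
    and "gperp = (mat 1 - PU) *v g" and "hperp = (mat 1 - PV) *v h"
    and "(norm gperp)\<^sup>2 + (norm hperp)\<^sup>2 \<noteq> 0"
    and "(mat 1 - PU) *v s \<noteq> 0" and "(mat 1 - PV) *v t \<noteq> 0"
    and "\<epsilon>\<^sub>s = norm ((mat 1 - PU) *v (s' - s)) / norm ((mat 1 - PU) *v s)"
    and "\<epsilon>\<^sub>t = norm ((mat 1 - PV) *v (t' - t)) / norm ((mat 1 - PV) *v t)"
    and "\<epsilon>' = max \<epsilon>\<^sub>s \<epsilon>\<^sub>t"
    and "\<alpha> = \<theta> - \<tau> + u \<bullet> (A *v t)"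
    and "\<beta> = \<theta> - \<tau> + v \<bullet> (transpose A *v s)"
    and "\<alpha>\<^sup>2 + \<beta>\<^sup>2 \<noteq> 0"
    and "\<gamma> = sgn (\<theta> - \<tau>) * (sqrt 2 / sqrt (\<alpha>\<^sup>2 + \<beta>\<^sup>2))"
    and "\<not> eigenvalue L \<gamma>"
    and "norm (B *v stack ((\<alpha> * \<gamma>) *\<^sub>R u) ((\<beta> * \<gamma>) *\<^sub>R v) - \<gamma> *\<^sub>R stack u v) \<noteq> 0"
    and "\<delta> = norm (B *v stack u v - \<gamma> *\<^sub>R stack u v) /
             norm (B *v stack ((\<alpha> * \<gamma>) *\<^sub>R u) ((\<beta> * \<gamma>) *\<^sub>R v) - \<gamma> *\<^sub>R stack u v)"
  shows "\<epsilon> \<le> 2 * sqrt 2 * \<delta> /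
           (sep \<gamma> L * \<bar>\<sigma> - \<tau>\<bar> * sqrt ((norm gperp)\<^sup>2 + (norm hperp)\<^sup>2)) * \<epsilon>'"
proof -
  note \<open>\<epsilon>' = max \<epsilon>\<^sub>s \<epsilon>\<^sub>t\<close> [simp]
  let ?I = "{1..CARD('n)}"
  define K where "K = shifted_aug \<tau> A"
  define \<rho> where "\<rho> = \<bar>\<sigma> - \<tau>\<bar>"
  define n where "n = norm (B *v stack u v - \<gamma> *\<^sub>R stack u v)"
  define D where "D = norm (stack ((mat 1 - PU) *v s) ((mat 1 - PV) *v t))"
  define l where "l = norm (stack s t)"
  define H where "H = sqrt ((norm gperp)\<^sup>2 + (norm hperp)\<^sup>2)"
  define a where "a = sep \<gamma> L"
  obtain us vs where us: "orthonormal_upto CARD('n) us" and vs: "orthonormal_upto CARD('n) vs"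
    and svd: "\<And>i. i \<in> ?I \<Longrightarrow> A *v vs i = sv i *\<^sub>R us i \<and> transpose A *v us i = sv i *\<^sub>R vs i"
    and nonneg: "\<And>i. i \<in> ?I \<Longrightarrow> 0 \<le> sv i"
    using \<open>singular_values A sv\<close> unfolding singular_values_def by blast
  have "(1::nat) \<in> ?I" by simp
  then have "\<sigma> \<noteq> \<tau>" using assms(6,7) by blast
  then have "0 < \<rho>" by (simp add: \<rho>_def)
  have gap: "\<rho> < \<bar>sv i - \<tau>\<bar>" if "i \<in> {2..CARD('n)}" for i
    using that assms(3,7) by (simp add: \<rho>_def)
  have gap': "\<rho> \<le> \<bar>sv i - \<tau>\<bar>" if "i \<in> ?I" for i
    using that gap[of i] assms(7) by (cases "i = 1") (auto simp: \<rho>_def)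

  \<comment> \<open>\<open>B\<close> is a true inverse only once \<open>K\<close> is known to be
    invertible; \<open>min \<rho> \<tau>\<close> bounds \<open>K\<close> from below also when \<rho>
    > \<tau>.\<close>
  have "y = 0" if "K *v y = 0" for y
  proof -
    obtain y\<^sub>1 y\<^sub>2 where y: "y = stack y\<^sub>1 y\<^sub>2" by (rule stack_exhaust)
    have "A *v y\<^sub>2 - \<tau> *\<^sub>R y\<^sub>1 = 0" "transpose A *v y\<^sub>1 - \<tau> *\<^sub>R y\<^sub>2 = 0"
      using that by (simp_all add: K_def y shifted_aug_mult_stack stack_eq_iff flip: stack_0)
    moreover have "(min \<rho> \<tau>)\<^sup>2 * ((norm y\<^sub>1)\<^sup>2 + (norm y\<^sub>2)\<^sup>2)
      \<le> (norm (A *v y\<^sub>2 - \<tau> *\<^sub>R y\<^sub>1))\<^sup>2 + (norm (transpose A *v y\<^sub>1 - \<tau> *\<^sub>R y\<^sub>2))\<^sup>2"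
      using gap' \<open>0 < \<rho>\<close> \<open>\<tau> > 0\<close>
      by (intro shifted_aug_lower_bound[OF us vs svd nonneg]) (auto simp: min_le_iff_disj)
    moreover have "0 < (min \<rho> \<tau>)\<^sup>2" using \<open>0 < \<rho>\<close> \<open>\<tau> > 0\<close> by simp
    ultimately have "(norm y)\<^sup>2 \<le> 0" by (simp add: y norm_stack mult_le_0_iff)
    then show ?thesis by simp
  qed
  then have "invertible K"
    by (simp add: invertible_left_inverse matrix_left_invertible_ker)
  then have inv: "B *v (K *v y) = y" "K *v (B *v y) = y" for y
    using matrix_inv_mult[of K] by (simp_all add: assms(9) matrix_vector_mul_assoc flip: K_def)

  note solution = correction_equation_solution[OF assms(26) \<open>norm u = 1\<close> \<open>norm v = 1\<close>,
      folded \<open>\<alpha> = _\<close> \<open>\<beta> = _\<close> K_def]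
  have z: "A *v (v + t) - \<tau> *\<^sub>R (u + s) = \<alpha> *\<^sub>R u" "transpose A *v (u + s) - \<tau> *\<^sub>R (v + t) = \<beta> *\<^sub>R v"
    using solution(1) by (simp_all add: K_def shifted_aug_mult_stack stack_eq_iff)
  have Bz: "B *v stack (\<alpha> *\<^sub>R u) (\<beta> *\<^sub>R v) = stack (u + s) (v + t)"
    using inv(1)[of "stack (u + s) (v + t)"] solution(1) by simp
  \<comment> \<open>The denominator of \<delta> turns out to be \<open>\<bar>\<gamma>\<bar>\<close>
    times the norm of \<open>(s, t)\<close>. Its being nonzero also excludes \<gamma> = 0, the value
    of the formula for \<theta> = \<tau>.\<close>
  have "B *v stack ((\<alpha> * \<gamma>) *\<^sub>R u) ((\<beta> * \<gamma>) *\<^sub>R v) = \<gamma> *\<^sub>R stack (u + s) (v + t)"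
    by (simp add: mult.commute[of _ \<gamma>] flip: scaleR_scaleR stack_scaleR Bz matrix_vector_mult_scaleR)
  then have residual: "B *v stack ((\<alpha> * \<gamma>) *\<^sub>R u) ((\<beta> * \<gamma>) *\<^sub>R v) - \<gamma> *\<^sub>R stack u v = \<gamma> *\<^sub>R stack s t"
    by (simp add: stack_add[symmetric] scaleR_right_distrib)
  then have "\<gamma> \<noteq> 0" using assms(44) by auto
  then have "\<bar>\<gamma>\<bar> * sqrt (\<alpha>\<^sup>2 + \<beta>\<^sup>2) = sqrt 2"
    using \<open>\<alpha>\<^sup>2 + \<beta>\<^sup>2 \<noteq> 0\<close> by (auto simp: assms(42) abs_mult sgn_if)

  note PU = orthogonal_projector_complement[OF assms(16)] and PV = orthogonal_projector_complement[OF assms(19)]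
  \<comment> \<open>\<open>t\<close> is nonzero because its projection is, and orthogonal to
    \<open>v\<close>; so a second singular value exists, as the case \<sigma> > 2 \<tau>
    requires.\<close>
  have "2 \<le> CARD('n)"
    by (rule independent_pair_card[OF solution(3)]) (use assms(23,35) in auto)
  have "v \<bullet> (v + t) = 1"
    using solution(3) \<open>norm v = 1\<close> by (simp add: inner_add_right norm_eq_1 inner_commute)
  have "0 < a" unfolding a_def by (rule sep_pos) fact
  have "\<bar>\<sigma> - \<tau>\<bar> * (\<bar>\<gamma>\<bar> * (a * norm (stack ((mat 1 - PU) *v (u + s)) ((mat 1 - PV) *v (v + t)))))
      \<le> 2 * sqrt 2 * norm (B *v stack u v - \<gamma> *\<^sub>R stack u v)"
  proof (rule projected_correction_bound[OF us vs svd nonneg _ \<open>\<sigma> = sv 1\<close> \<open>\<sigma> \<noteq> \<tau>\<close> \<open>\<tau> > 0\<close> \<open>2 \<le> CARD('n)\<close>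
        assms(8) assms(10) inv[unfolded K_def] _ _ \<open>norm u = 1\<close> \<open>norm v = 1\<close> z \<open>v \<bullet> (v + t) = 1\<close>])
    show "a * norm y \<le> norm (B *v y - \<gamma> *\<^sub>R y)" if "w \<bullet> y = 0" for y
      unfolding a_def using assms(12,13,43) that by (rule sep_compression_le)
  qed (use gap \<open>0 < a\<close> PU PV assms(20,22) \<open>\<bar>\<gamma>\<bar> * sqrt (\<alpha>\<^sup>2 + \<beta>\<^sup>2) = sqrt 2\<close> in \<open>auto simp: \<rho>_def\<close>)
  \<comment> \<open>The complementary projectors annihilate \<open>u\<close> and \<open>v\<close>,
    so only \<open>s\<close> and \<open>t\<close> remain.\<close>
  then have main: "\<rho> * (\<bar>\<gamma>\<bar> * (a * D)) \<le> 2 * sqrt 2 * n"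
    using PU(1)[OF \<open>u \<in> U\<close>] PV(1)[OF \<open>v \<in> V\<close>]
    by (simp add: \<rho>_def D_def n_def matrix_vector_right_distrib)

  have "0 < l" using \<open>stack s t \<noteq> 0\<close> by (simp add: l_def)
  have "0 < H" using assms(33) by (simp add: H_def order_less_le sum_power2_eq_zero_iff)
  have \<delta>: "\<delta> = n / (\<bar>\<gamma>\<bar> * l)"
    by (simp add: assms(45) residual n_def l_def)
  have "0 \<le> \<epsilon>" by (simp add: assms(28))
  from expansion_accuracy_bound[OF assms(29) this assms(34-37)]
  have acc: "\<epsilon> * l * H \<le> \<epsilon>' * D"
    by (simp add: l_def H_def D_def assms(31,32))
  have "0 \<le> \<epsilon>'" by (simp add: assms(36) le_max_iff_disj)
  have "(\<epsilon> * l * H) * (\<rho> * (\<bar>\<gamma>\<bar> * a)) \<le> (\<epsilon>' * D) * (\<rho> * (\<bar>\<gamma>\<bar> * a))"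
    using acc \<open>0 < \<rho>\<close> \<open>0 < a\<close> by (intro mult_right_mono) auto
  also have "\<dots> = \<epsilon>' * (\<rho> * (\<bar>\<gamma>\<bar> * (a * D)))" by (simp only: mult_ac)
  also have "\<dots> \<le> \<epsilon>' * (2 * sqrt 2 * n)"
    using main \<open>0 \<le> \<epsilon>'\<close> by (rule mult_left_mono)
  finally have "\<epsilon> \<le> \<epsilon>' * (2 * sqrt 2 * n) / (l * H * (\<rho> * (\<bar>\<gamma>\<bar> * a)))"
    using \<open>0 < l\<close> \<open>0 < H\<close> \<open>0 < \<rho>\<close> \<open>0 < a\<close> \<open>\<gamma> \<noteq> 0\<close> by (simp add: pos_le_divide_eq mult.assoc)
  also have "\<dots> = 2 * sqrt 2 * \<delta> / (a * \<rho> * H) * \<epsilon>'"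
    by (simp add: \<delta> mult_ac)
  finally show ?thesis by (simp only: a_def \<rho>_def H_def)
qed

end
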